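(* Let $n\ge 3$, $\alpha>0$ and $\beta>1$. There exists $M_0>0$ such that for every $M\ge M_0$ the set $$\Omega_{\alpha\beta}=\{(z_1,z',z_n)\in\mathbb{C}^n: r(z_1,z',z_n)<0\},$$ $$r(z_1,z',z_n)=\left|z_1-e^{2i\alpha\ln|z_n|}\right|^2+|z'|^2-1+\sigma(|z_n|^2-\beta^2)+\sigma(1-|z_n|^2),$$ where $\sigma(t)=Me^{-1/t}$ for $t>0$ and $\sigma(t)=0$ for $t\le0$, is a smooth bounded pseudoconvex domain.
   Context: Points of $\mathbb{C}^n$ are written $z=(z_1,z',z_n)$ with $z'=(z_2,\dots,z_{n-1})$ and $|z'|^2=|z_2|^2+\cdots+|z_{n-1}|^2$. The function $r$ is defined for $z_n\ne 0$, and points with $z_n=0$ are not in $\Omega_{\alpha\beta}$. A domain is called smooth if its boundary is a smooth ($C^\infty$) manifold. *)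

theory Defs
  imports "HOL-Analysis.Analysis"
begin

section \<open>Smooth functions and domains with smooth boundary\<close>

text \<open>Intended for open sets \<open>S\<close>: all iterated directional derivatives up to order \<open>k\<close>
  exist and are continuous, i.e. \<open>f\<close> is of class $C^k$ on \<open>S\<close>.\<close>

primrec Ck_on :: "nat \<Rightarrow> 'a::euclidean_space set \<Rightarrow> ('a \<Rightarrow> real) \<Rightarrow> bool" where
  "Ck_on 0 S f \<longleftrightarrow> continuous_on S f"
| "Ck_on (Suc k) S f \<longleftrightarrow>
     (\<forall>x\<in>S. f differentiable (at x)) \<and>
     (\<forall>v. Ck_on k S (\<lambda>x. frechet_derivative f (at x) v))"

definition smooth_on :: "'a::euclidean_space set \<Rightarrow> ('a \<Rightarrow> real) \<Rightarrow> bool" where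
  "smooth_on S f \<longleftrightarrow> (\<forall>k. Ck_on k S f)"

definition is_domain :: "'a::euclidean_space set \<Rightarrow> bool" where
  "is_domain \<Omega> \<longleftrightarrow> open \<Omega> \<and> connected \<Omega> \<and> \<Omega> \<noteq> {}"

definition local_defining_function ::
    "'a::euclidean_space set \<Rightarrow> 'a set \<Rightarrow> ('a \<Rightarrow> real) \<Rightarrow> bool" where
  "local_defining_function \<Omega> U \<rho> \<longleftrightarrow>
     open U \<and> smooth_on U \<rho> \<and>
     (\<forall>x\<in>U. frechet_derivative \<rho> (at x) \<noteq> (\<lambda>v. 0)) \<and>
     U \<inter> \<Omega> = {x \<in> U. \<rho> x < 0} \<and>
     U \<inter> frontier \<Omega> = {x \<in> U. \<rho> x = 0}"

text \<open>The boundary is an embedded $C^\infty$ hypersurface (locally a regular level set), with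
  \<open>\<Omega>\<close> lying locally on one side of it.\<close>

definition smooth_boundary :: "'a::euclidean_space set \<Rightarrow> bool" where
  "smooth_boundary \<Omega> \<longleftrightarrow>
     (\<forall>p \<in> frontier \<Omega>. \<exists>U \<rho>. p \<in> U \<and> local_defining_function \<Omega> U \<rho>)"


section \<open>The Levi form and pseudoconvexity\<close>

text \<open>The Wirtinger derivatives $\partial/\partial z_j = (\partial/\partial x_j -
  i\,\partial/\partial y_j)/2$ and $\partial/\partial\bar z_j = (\partial/\partial x_j +
  i\,\partial/\partial y_j)/2$; the vectors \<open>axis j 1\<close> and \<open>axis j \<i>\<close> are the real
  coordinate directions of $x_j$ and $y_j$.\<close>

definition d_z :: "'n \<Rightarrow> (complex ^ 'n \<Rightarrow> complex) \<Rightarrow> complex ^ 'n \<Rightarrow> complex" where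
  "d_z j f p = (frechet_derivative f (at p) (axis j 1)
                - \<i> * frechet_derivative f (at p) (axis j \<i>)) / 2"

definition d_zbar :: "'n \<Rightarrow> (complex ^ 'n \<Rightarrow> complex) \<Rightarrow> complex ^ 'n \<Rightarrow> complex" where
  "d_zbar j f p = (frechet_derivative f (at p) (axis j 1)
                   + \<i> * frechet_derivative f (at p) (axis j \<i>)) / 2"

definition levi_form ::
    "(complex ^ 'n \<Rightarrow> real) \<Rightarrow> complex ^ 'n \<Rightarrow> complex ^ 'n \<Rightarrow> complex" where
  "levi_form \<rho> p w =
     (\<Sum>j\<in>UNIV. \<Sum>k\<in>UNIV.
        d_z j (d_zbar k (\<lambda>z. complex_of_real (\<rho> z))) p * w $ j * cnj (w $ k))"

definition complex_tangent ::
    "(complex ^ 'n \<Rightarrow> real) \<Rightarrow> complex ^ 'n \<Rightarrow> (complex ^ 'n) set" where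
  "complex_tangent \<rho> p =
     {w. (\<Sum>j\<in>UNIV. d_z j (\<lambda>z. complex_of_real (\<rho> z)) p * w $ j) = 0}"

text \<open>(Levi) pseudoconvexity of a domain with smooth boundary. The complex tangent space does
  not depend on the defining function, and the Levi form restricted to it changes only by a
  positive factor; so it does not matter which local defining function is used. For smooth
  \<open>\<rho>\<close> the Levi form is Hermitian, so \<open>Re\<close> only converts its real value to type \<open>real\<close>.\<close>

definition pseudoconvex :: "(complex ^ 'n) set \<Rightarrow> bool" where
  "pseudoconvex \<Omega> \<longleftrightarrow>
     (\<forall>p \<in> frontier \<Omega>. \<exists>U \<rho>. p \<in> U \<and> local_defining_function \<Omega> U \<rho> \<and>
        (\<forall>w \<in> complex_tangent \<rho> p. 0 \<le> Re (levi_form \<rho> p w)))"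

definition smooth_bounded_pseudoconvex_domain :: "(complex ^ 'n) set \<Rightarrow> bool" where
  "smooth_bounded_pseudoconvex_domain \<Omega> \<longleftrightarrow>
     is_domain \<Omega> \<and> bounded \<Omega> \<and> smooth_boundary \<Omega> \<and> pseudoconvex \<Omega>"


section \<open>The domains\<close>

text \<open>Coordinates are indexed by an arbitrary finite linearly ordered type; $z_1$ and $z_n$
  are the coordinates at its least and its greatest element.\<close>

definition first_index :: "'n::{finite,linorder}" where
  "first_index = Min UNIV"

definition last_index :: "'n::{finite,linorder}" where
  "last_index = Max UNIV"

definition \<sigma> :: "real \<Rightarrow> real \<Rightarrow> real" where
  "\<sigma> M t = (if t > 0 then M * exp (- 1 / t) else 0)"

definition worm_r ::
    "real \<Rightarrow> real \<Rightarrow> real \<Rightarrow> complex ^ 'n::{finite,linorder} \<Rightarrow> real" where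
  "worm_r \<alpha> \<beta> M z =
     (let z1 = z $ first_index; zn = z $ last_index in
        (cmod (z1 - exp (2 * \<i> * complex_of_real \<alpha> * complex_of_real (ln (cmod zn)))))\<^sup>2
        + (\<Sum>j \<in> UNIV - {first_index, last_index}. (cmod (z $ j))\<^sup>2)
        - 1 + \<sigma> M ((cmod zn)\<^sup>2 - \<beta>\<^sup>2) + \<sigma> M (1 - (cmod zn)\<^sup>2))"

text \<open>The condition \<open>z $ last_index \<noteq> 0\<close> is needed because \<open>ln 0 = 0\<close> makes \<open>worm_r\<close> total.\<close>

definition worm_domain ::
    "real \<Rightarrow> real \<Rightarrow> real \<Rightarrow> (complex ^ 'n::{finite,linorder}) set" where
  "worm_domain \<alpha> \<beta> M = {z. z $ last_index \<noteq> 0 \<and> worm_r \<alpha> \<beta> M z < 0}"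

end

theory Submission
  imports Defs
begin

text \<open>Fix a boundary point with last coordinate \<open>q\<close> and write \<open>w\<close> for the last coordinate. On the half
plane \<open>Re (w * cnj q) > 0\<close> there is a holomorphic branch \<open>F\<close> of \<open>w powr (- \<i> * \<alpha>)\<close>
(\<open>twist\<close>), and \<open>\<bar>F\<bar>\<^sup>2 * exp (- 2 * \<i> * \<alpha> * ln \<bar>w\<bar>) = F\<^sup>2\<close>: the modulus of \<open>F\<close> grows with the
argument of \<open>w\<close>, and this compensates exactly for the phase that rotates the discs of the worm.
Multiplying \<open>r\<close> by the positive function \<open>\<bar>F\<bar>\<^sup>2\<close> therefore gives the local defining function
\<open>\<rho> = (\<Sum>j\<noteq>n. \<bar>z\<^sub>j * F\<bar>\<^sup>2) - 2 * Re (z\<^sub>1 * F\<^sup>2) + \<bar>F\<bar>\<^sup>2 * \<lambda>(\<bar>w\<bar>\<^sup>2)\<close> with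
\<open>\<lambda>(\<tau>) = \<sigma>(\<tau> - \<beta>\<^sup>2) + \<sigma>(1 - \<tau>)\<close> (\<open>twisted_worm_r_eq\<close>). The first sum consists of squared moduli of
holomorphic functions and the second term is pluriharmonic, so the Levi form of \<open>\<rho>\<close> is
non-negative in all directions, not merely in the complex tangent ones, as soon as
\<open>\<bar>F\<bar>\<^sup>2 * \<lambda>(\<bar>w\<bar>\<^sup>2)\<close> is subharmonic. A quarter of its Laplacian is
\<open>\<bar>F\<bar>\<^sup>2 * (\<alpha>\<^sup>2 * \<lambda> / \<tau> + \<lambda>' + \<tau> * \<lambda>'')\<close>, and \<open>\<lambda>' + \<tau> * \<lambda>'' \<ge> 0\<close> whenever the arguments of both
\<open>\<sigma>\<close> are at most \<open>1 / 3\<close> (\<open>wall_subharmonic\<close>).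

This is the role of \<open>M\<close>: where \<open>r \<le> 0\<close> one has \<open>\<lambda> \<le> 1\<close>, so \<open>M * exp (- 1 / t) \<le> 1\<close> for the
arguments \<open>t\<close> of \<open>\<sigma>\<close>, and \<open>M \<ge> exp 3\<close> forces \<open>t \<le> 1 / 3\<close> (\<open>wall_small\<close>). The same estimate keeps
the closure of the domain away from \<open>w = 0\<close>, where \<open>r\<close> is not smooth, and bounds the domain.

The boundary is the zero set of \<open>r\<close> (\<open>frontier_worm_domain\<close>), because \<open>r\<close> has no critical
points there (\<open>worm_r_derivative_nonzero\<close>): off the curve of centres, \<open>r\<close> changes strictly towards
the centre, and at a centre \<open>\<lambda> = 1\<close>, so that \<open>r\<close> changes when \<open>\<bar>w\<bar>\<close> does. Finally, the domain
is connected because every fibre over \<open>w\<close> is a ball around the centre over \<open>w\<close>, and the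
centres are parametrised by the annulus \<open>\<lambda>(\<bar>w\<bar>\<^sup>2) < 1\<close>.\<close>

section \<open>Calculus of $C^k$ functions\<close>

text \<open>On an open set the iterated derivatives depend only on the values of the function there. This
makes it possible to exchange a function for a formula that is valid only on the set, such as an
arctangent for a branch of the argument.\<close>

lemma Ck_on_cong:
  assumes "open S" "\<And>x. x \<in> S \<Longrightarrow> f x = g x"
  shows "Ck_on k S f \<longleftrightarrow> Ck_on k S g"
  using assms(2)
proof (induction k arbitrary: f g)
  case 0
  then show ?case by (simp cong: continuous_on_cong)
next
  case (Suc k)
  \<comment> \<open>The derivatives agree as relations, so that the description operator in
    \<open>frechet_derivative\<close> picks the same value even where neither function is differentiable.\<close>
  have D: "(f has_derivative D) (at x) \<longleftrightarrow> (g has_derivative D) (at x)" if "x \<in> S" for x D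
    using has_derivative_transform_within_open[OF _ assms(1) that, of f D UNIV g]
      has_derivative_transform_within_open[OF _ assms(1) that, of g D UNIV f] Suc.prems by auto
  then have E: "frechet_derivative f (at x) = frechet_derivative g (at x)" if "x \<in> S" for x
    using that unfolding frechet_derivative_def by simp
  have "Ck_on k S (\<lambda>x. frechet_derivative f (at x) v) \<longleftrightarrow> Ck_on k S (\<lambda>x. frechet_derivative g (at x) v)" for v
    by (rule Suc.IH) (simp add: E)
  then show ?case
    using D by (simp add: differentiable_def)
qed

lemma Ck_on_SucI:
  assumes "open S" "\<And>x. x \<in> S \<Longrightarrow> (f has_derivative f' x) (at x)"
    and "\<And>v. Ck_on k S (\<lambda>x. f' x v)"
  shows "Ck_on (Suc k) S f"
proof -
  have "Ck_on k S (\<lambda>x. frechet_derivative f (at x) v)" for v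
    by (rule Ck_on_cong[OF assms(1), THEN iffD2, OF _ assms(3)]) (simp add: frechet_derivative_at[OF assms(2), symmetric])
  then show ?thesis
    using assms(2) by (auto simp: differentiable_def)
qed

lemma Ck_on_Suc_has_derivative:
  assumes "Ck_on (Suc k) S f" "x \<in> S"
  shows "(f has_derivative frechet_derivative f (at x)) (at x)"
  using assms frechet_derivative_works by auto

lemma Ck_on_Suc_frechet: "Ck_on (Suc k) S f \<Longrightarrow> Ck_on k S (\<lambda>x. frechet_derivative f (at x) v)"
  by simp

lemma Ck_on_Suc_imp: "Ck_on (Suc k) S f \<Longrightarrow> Ck_on k S f"
proof (induction k arbitrary: f)
  case 0
  then show ?case
    by (auto intro!: continuous_at_imp_continuous_on differentiable_imp_continuous_within)
qed auto

declare Ck_on.simps(2) [simp del]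

lemma Ck_on_subset: "Ck_on k S f \<Longrightarrow> T \<subseteq> S \<Longrightarrow> Ck_on k T f"
  by (induction k arbitrary: f) (auto simp: Ck_on.simps(2) intro: continuous_on_subset)

lemma Ck_on_const: "open S \<Longrightarrow> Ck_on k S (\<lambda>x. c)"
proof (induction k arbitrary: c)
  case (Suc k)
  show ?case
    by (rule Ck_on_SucI[OF Suc.prems has_derivative_const Suc.IH[OF Suc.prems]])
qed simp

lemma Ck_on_linear: "open S \<Longrightarrow> bounded_linear f \<Longrightarrow> Ck_on k S f"
proof (cases k)
  case (Suc m)
  assume *: "open S" "bounded_linear f"
  show ?thesis unfolding Suc
    by (rule Ck_on_SucI[OF *(1) bounded_linear_imp_has_derivative[OF *(2)] Ck_on_const[OF *(1)]])
qed (auto simp: linear_continuous_on)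

lemma Ck_on_add:
  assumes "open S" "Ck_on k S f" "Ck_on k S g"
  shows "Ck_on k S (\<lambda>x. f x + g x)"
  using assms(2,3)
proof (induction k arbitrary: f g)
  case (Suc k)
  show ?case
    by (rule Ck_on_SucI[OF assms(1) has_derivative_add[OF Ck_on_Suc_has_derivative[OF Suc.prems(1)]
            Ck_on_Suc_has_derivative[OF Suc.prems(2)]] Suc.IH[OF Suc.prems[THEN Ck_on_Suc_frechet]]])
qed (simp add: continuous_on_add)

lemma Ck_on_mult:
  assumes "open S" "Ck_on k S f" "Ck_on k S g"
  shows "Ck_on k S (\<lambda>x. f x * g x)"
  using assms(2,3)
proof (induction k arbitrary: f g)
  case (Suc k)
  show ?case
  proof (rule Ck_on_SucI[OF assms(1)])
    show "((\<lambda>x. f x * g x) has_derivative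
        (\<lambda>v. f x * frechet_derivative g (at x) v + frechet_derivative f (at x) v * g x)) (at x)"
      if "x \<in> S" for x
      by (rule has_derivative_mult[OF Ck_on_Suc_has_derivative[OF Suc.prems(1) that]
            Ck_on_Suc_has_derivative[OF Suc.prems(2) that]])
    show "Ck_on k S (\<lambda>x. f x * frechet_derivative g (at x) v + frechet_derivative f (at x) v * g x)" for v
      by (intro Ck_on_add[OF assms(1)] Suc.IH Suc.prems[THEN Ck_on_Suc_imp] Suc.prems[THEN Ck_on_Suc_frechet])
  qed
qed (simp add: continuous_on_mult)

text \<open>The inductive step for composition with a function of one real variable. Stated for one step, it
serves all the functions below, each of which closes the induction with its own derivative formula.\<close>

lemma Ck_on_compose_Suc:
  assumes "open S" "Ck_on (Suc k) S g"
    and "\<And>x. x \<in> S \<Longrightarrow> (\<phi> has_real_derivative \<phi>' (g x)) (at (g x))"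
    and "Ck_on k S (\<lambda>x. \<phi>' (g x))"
  shows "Ck_on (Suc k) S (\<lambda>x. \<phi> (g x))"
proof (rule Ck_on_SucI[OF assms(1)])
  show "((\<lambda>x. \<phi> (g x)) has_derivative (\<lambda>v. \<phi>' (g x) * frechet_derivative g (at x) v)) (at x)"
    if "x \<in> S" for x
    using has_derivative_compose[OF Ck_on_Suc_has_derivative[OF assms(2) that]
        assms(3)[OF that, unfolded has_field_derivative_def]] .
  show "Ck_on k S (\<lambda>x. \<phi>' (g x) * frechet_derivative g (at x) v)" for v
    by (rule Ck_on_mult[OF assms(1,4) Ck_on_Suc_frechet[OF assms(2)]])
qed

lemma Ck_on_exp:
  assumes "open S" "Ck_on k S g"
  shows "Ck_on k S (\<lambda>x. exp (g x))"
  using assms(2)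
proof (induction k)
  case (Suc k)
  show ?case
    by (rule Ck_on_compose_Suc[where \<phi> = exp and \<phi>' = exp, OF assms(1) Suc.prems DERIV_exp
          Suc.IH[OF Ck_on_Suc_imp[OF Suc.prems]]])
qed (simp add: continuous_on_exp)

lemma Ck_on_sin_cos:
  assumes "open S" "Ck_on k S g"
  shows "Ck_on k S (\<lambda>x. sin (g x)) \<and> Ck_on k S (\<lambda>x. cos (g x))"
  using assms(2)
proof (induction k)
  case (Suc k)
  from Suc.IH[OF Ck_on_Suc_imp[OF Suc.prems]]
  have "Ck_on k S (\<lambda>x. sin (g x))" "Ck_on k S (\<lambda>x. cos (g x))" by simp_all
  moreover from this have "Ck_on k S (\<lambda>x. (-1) * sin (g x))"
    by (intro Ck_on_mult Ck_on_const assms)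
  ultimately show ?case
  proof (intro conjI)
    show "Ck_on (Suc k) S (\<lambda>x. sin (g x))"
      by (rule Ck_on_compose_Suc[OF assms(1) Suc.prems DERIV_sin \<open>Ck_on k S (\<lambda>x. cos (g x))\<close>])
    show "Ck_on (Suc k) S (\<lambda>x. cos (g x))"
      by (rule Ck_on_compose_Suc[OF assms(1) Suc.prems, where \<phi> = cos and \<phi>' = "\<lambda>x. (-1) * sin x"])
        (simp only: mult_minus1 DERIV_cos, fact)
  qed
qed (simp add: continuous_on_sin continuous_on_cos)

lemma Ck_on_inverse:
  assumes "open S" "Ck_on k S g" "\<And>x. x \<in> S \<Longrightarrow> g x \<noteq> 0"
  shows "Ck_on k S (\<lambda>x. inverse (g x))"
  using assms(2)
proof (induction k)
  case (Suc k)
  have "Ck_on k S (\<lambda>x. inverse (g x))"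
    by (rule Suc.IH[OF Ck_on_Suc_imp[OF Suc.prems]])
  then have "Ck_on k S (\<lambda>x. (-1) * (inverse (g x) * inverse (g x)))"
    by (intro Ck_on_mult Ck_on_const assms)
  then show ?case
    using assms(3) by (intro Ck_on_compose_Suc[OF assms(1) Suc.prems,
        where \<phi>' = "\<lambda>y. (-1) * (inverse y * inverse y)"])
     (auto intro!: derivative_eq_intros simp: power2_eq_square)
qed (use assms in \<open>simp add: continuous_on_inverse\<close>)

lemma Ck_on_ln:
  assumes "open S" "Ck_on k S g" "\<And>x. x \<in> S \<Longrightarrow> g x > 0"
  shows "Ck_on k S (\<lambda>x. ln (g x))"
proof (cases k)
  case 0
  then show ?thesis using assms continuous_on_ln[of S g] by force
next
  case (Suc m)
  have "Ck_on m S g" using Ck_on_Suc_imp[OF assms(2)[unfolded Suc]] .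
  then show ?thesis unfolding Suc using assms
    by (intro Ck_on_compose_Suc[OF assms(1) assms(2)[unfolded Suc], where \<phi>' = inverse])
      (use assms(3) in \<open>fastforce intro: DERIV_ln Ck_on_inverse[OF assms(1)]\<close>)+
qed

lemma Ck_on_arctan:
  assumes "open S" "Ck_on k S g"
  shows "Ck_on k S (\<lambda>x. arctan (g x))"
proof (cases k)
  case 0
  then show ?thesis using assms by (simp add: continuous_on_arctan)
next
  case (Suc m)
  have "Ck_on m S g" using Ck_on_Suc_imp[OF assms(2)[unfolded Suc]] .
  moreover have "1 + y * y \<noteq> 0" for y :: real
    using zero_le_square[of y] by linarith
  ultimately have "Ck_on m S (\<lambda>x. inverse (1 + g x * g x))"
    by (intro Ck_on_inverse Ck_on_add Ck_on_mult Ck_on_const assms(1))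
  then show ?thesis unfolding Suc
    by (intro Ck_on_compose_Suc[OF assms(1) assms(2)[unfolded Suc], where \<phi>' = "\<lambda>y. inverse (1 + y * y)"])
      (auto simp flip: power2_eq_square intro: DERIV_arctan)
qed

lemma Ck_on_sum:
  assumes "open S" "\<And>i. i \<in> I \<Longrightarrow> Ck_on k S (f i)"
  shows "Ck_on k S (\<lambda>x. \<Sum>i\<in>I. f i x)"
  using assms(2)
  by (induction I rule: infinite_finite_induct) (auto intro!: Ck_on_const Ck_on_add assms(1))

lemma Ck_on_Re_Im_component:
  assumes "open S"
  shows "Ck_on k S (\<lambda>z :: complex ^ 'n. Re (z $ j))" "Ck_on k S (\<lambda>z :: complex ^ 'n. Im (z $ j))"
  by (intro Ck_on_linear assms bounded_linear_compose[OF bounded_linear_Re]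
      bounded_linear_compose[OF bounded_linear_Im] bounded_linear_vec_nth)+

section \<open>Functions that are flat at the origin\<close>

text \<open>The function \<open>\<sigma>\<close> alone is not closed under differentiation, but the span of its products with powers of
\<open>1 / t\<close> is; hence the family.\<close>

definition flat :: "nat \<Rightarrow> real \<Rightarrow> real" where
  "flat m t = (if t > 0 then (1 / t) ^ m * exp (- 1 / t) else 0)"

lemma \<sigma>_eq_flat: "\<sigma> M t = M * flat 0 t"
  by (simp add: \<sigma>_def flat_def)

lemma flat_nonpos [simp]: "t \<le> 0 \<Longrightarrow> flat m t = 0"
  by (simp add: flat_def)

lemma flat_pos: "t > 0 \<Longrightarrow> flat m t > 0"
  by (simp add: flat_def)

lemma flat_Suc: "flat m t = t * flat (Suc m) t"
  by (simp add: flat_def)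

lemma flat_tendsto_0: "(flat m \<longlongrightarrow> 0) (at 0)"
proof -
  have "((\<lambda>t::real. (inverse t) ^ m / exp (inverse t)) \<longlongrightarrow> 0) (at_right 0)"
    using filterlim_compose[OF tendsto_power_div_exp_0 filterlim_inverse_at_top_right] .
  moreover have "\<forall>\<^sub>F t in at_right 0. (inverse t) ^ m / exp (inverse t) = flat m t"
    unfolding eventually_at_right_field
    by (rule exI[of _ 1]) (auto simp: flat_def exp_minus field_simps)
  ultimately have R: "(flat m \<longlongrightarrow> 0) (at_right 0)"
    by (rule Lim_transform_eventually)
  have "(flat m \<longlongrightarrow> 0) (at_left 0)"
    by (rule Lim_transform_eventually[of "\<lambda>_. 0"])
      (auto simp: eventually_at_left_field intro!: exI[of _ "-1"])
  with R show ?thesis by (simp add: filterlim_split_at)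
qed

text \<open>At the origin the difference quotient of \<open>flat m\<close> is \<open>flat (m + 1)\<close>, which tends to zero; so
the formula for positive arguments persists at \<open>0\<close> with value \<open>0\<close>, and by iteration
every \<open>flat m\<close> is of class $C^\infty$ on the whole line.\<close>

lemma flat_has_derivative:
  "(flat m has_real_derivative flat (m + 2) t - m * flat (m + 1) t) (at t)"
proof -
  consider "t > 0" | "t < 0" | "t = 0" by linarith
  then show ?thesis
  proof cases
    case 1
    have inv: "((\<lambda>t. 1 / t) has_real_derivative - (1 / t)\<^sup>2) (at t)"
      using 1 by (auto intro!: derivative_eq_intros simp: power2_eq_square field_simps)
    have pow: "((\<lambda>t. (1 / t) ^ m) has_real_derivative - m * (1 / t) ^ (m + 1)) (at t)"
    proof (cases m)
      case (Suc n)
      show ?thesis unfolding Suc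
        by (rule DERIV_cong[OF DERIV_power_Suc[OF inv]]) (simp add: power2_eq_square add_divide_distrib diff_divide_distrib algebra_simps)
    qed simp
    have expo: "((\<lambda>t. exp (- 1 / t)) has_real_derivative exp (- 1 / t) * (1 / t)\<^sup>2) (at t)"
      using DERIV_chain2[OF DERIV_exp DERIV_minus[OF inv]] by simp
    have "((\<lambda>t. (1 / t) ^ m * exp (- 1 / t)) has_real_derivative flat (m + 2) t - m * flat (m + 1) t) (at t)"
      using DERIV_mult[OF pow expo] 1 by (simp add: flat_def power2_eq_square algebra_simps)
    then show ?thesis
      by (rule has_field_derivative_transform_within_open[where S = "{0<..}"]) (use 1 in \<open>auto simp: flat_def\<close>)
  next
    case 2
    have "((\<lambda>t::real. 0) has_real_derivative 0) (at t)" by simp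
    then have "(flat m has_real_derivative 0) (at t)"
      by (rule has_field_derivative_transform_within_open[where S = "{..<0}"]) (use 2 in auto)
    with 2 show ?thesis by simp
  next
    case 3
    have "((\<lambda>h. (flat m (0 + h) - flat m 0) / h) \<longlongrightarrow> 0) (at 0)"
    proof (rule Lim_transform_eventually[OF flat_tendsto_0[of "Suc m"]])
      show "\<forall>\<^sub>F h in at 0. flat (Suc m) h = (flat m (0 + h) - flat m 0) / h"
        by (auto simp: eventually_at_filter flat_Suc[of m])
    qed
    with 3 show ?thesis by (simp add: DERIV_def)
  qed
qed

lemma Ck_on_flat:
  assumes "open S" "Ck_on k S g"
  shows "Ck_on k S (\<lambda>x. flat m (g x))"
  using assms(2)
proof (induction k arbitrary: m)
  case 0
  have "continuous_on UNIV (flat m)"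
    by (intro continuous_at_imp_continuous_on ballI DERIV_isCont[OF flat_has_derivative])
  from continuous_on_compose2[OF this, of S g] 0 show ?case by simp
next
  case (Suc k)
  have IH: "Ck_on k S (\<lambda>x. flat m (g x))" for m
    by (rule Suc.IH[OF Ck_on_Suc_imp[OF Suc.prems]])
  define \<phi>' where "\<phi>' t = flat (m + 2) t + (- real m) * flat (m + 1) t" for t
  have "(flat m has_real_derivative \<phi>' (g x)) (at (g x))" for x
    using flat_has_derivative[of m "g x"] by (simp add: \<phi>'_def)
  moreover have "Ck_on k S (\<lambda>x. \<phi>' (g x))"
    unfolding \<phi>'_def by (intro Ck_on_add[OF assms(1)] Ck_on_mult[OF assms(1)] Ck_on_const[OF assms(1)] IH)
  ultimately show ?case
    by (rule Ck_on_compose_Suc[OF assms(1) Suc.prems])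
qed

section \<open>Wirtinger derivatives and the sign of the Levi form\<close>

text \<open>The real derivative split into its complex linear part \<open>a\<close> and its conjugate linear part
\<open>b\<close>, which are the Wirtinger derivatives of \<open>f\<close>. Since \<open>f\<close> is
differentiable as a function of all variables together, product and chain rules hold without a
continuity condition on the partial derivatives.\<close>

definition has_wirtinger ::
    "(complex ^ 'n \<Rightarrow> complex) \<Rightarrow> ('n \<Rightarrow> complex) \<Rightarrow> ('n \<Rightarrow> complex) \<Rightarrow> complex ^ 'n \<Rightarrow> bool" where
  "has_wirtinger f a b p \<longleftrightarrow>
     (f has_derivative (\<lambda>v. \<Sum>j\<in>UNIV. a j * v $ j + b j * cnj (v $ j))) (at p)"

lemma
  assumes "has_wirtinger f a b p"
  shows d_z_eq: "d_z j f p = a j" and d_zbar_eq: "d_zbar j f p = b j"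
proof -
  have D: "frechet_derivative f (at p) = (\<lambda>v. \<Sum>j\<in>UNIV. a j * v $ j + b j * cnj (v $ j))"
    using frechet_derivative_at[OF assms[unfolded has_wirtinger_def]] by simp
  have "frechet_derivative f (at p) (axis j c) = a j * c + b j * cnj c" for c
  proof -
    have "frechet_derivative f (at p) (axis j c) =
        (\<Sum>i\<in>UNIV. if i = j then a j * c + b j * cnj c else 0)"
      unfolding D by (rule sum.cong) (auto simp: axis_def)
    then show ?thesis by simp
  qed
  then show "d_z j f p = a j" "d_zbar j f p = b j"
    by (simp_all add: d_z_def d_zbar_def algebra_simps)
qed

lemma has_wirtinger_cong:
  assumes "open V" "p \<in> V" "\<And>x. x \<in> V \<Longrightarrow> f x = g x" "has_wirtinger f a b p"
  shows "has_wirtinger g a b p"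
  using has_derivative_transform_within_open[OF assms(4)[unfolded has_wirtinger_def] assms(1,2)] assms(3)
  by (simp add: has_wirtinger_def)

lemma has_wirtinger_const: "has_wirtinger (\<lambda>_. c) (\<lambda>_. 0) (\<lambda>_. 0) p"
  by (simp add: has_wirtinger_def)

lemma has_wirtinger_add:
  assumes "has_wirtinger f a b p" "has_wirtinger g c d p"
  shows "has_wirtinger (\<lambda>x. f x + g x) (\<lambda>j. a j + c j) (\<lambda>j. b j + d j) p"
  using has_derivative_add[OF assms[unfolded has_wirtinger_def]]
  by (simp add: has_wirtinger_def algebra_simps sum.distrib)

lemma has_wirtinger_mult:
  assumes "has_wirtinger f a b p" "has_wirtinger g c d p"
  shows "has_wirtinger (\<lambda>x. f x * g x) (\<lambda>j. f p * c j + a j * g p) (\<lambda>j. f p * d j + b j * g p) p"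
  using has_derivative_mult[OF assms[unfolded has_wirtinger_def]]
  by (simp add: has_wirtinger_def algebra_simps sum.distrib sum_distrib_left)

lemma has_wirtinger_cnj:
  assumes "has_wirtinger f a b p"
  shows "has_wirtinger (\<lambda>x. cnj (f x)) (\<lambda>j. cnj (b j)) (\<lambda>j. cnj (a j)) p"
  using has_derivative_cnj[OF assms[unfolded has_wirtinger_def]]
  by (simp add: has_wirtinger_def algebra_simps)

lemma has_wirtinger_coordinate:
  assumes "(\<phi> has_derivative (\<lambda>v. A * v + B * cnj v)) (at (p $ l))"
  shows "has_wirtinger (\<lambda>x. \<phi> (x $ l)) (\<lambda>j. if j = l then A else 0) (\<lambda>j. if j = l then B else 0) p"
proof -
  have "((\<lambda>x. \<phi> (x $ l)) has_derivative (\<lambda>v. A * v $ l + B * cnj (v $ l))) (at p)"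
    using has_derivative_compose[OF bounded_linear_imp_has_derivative[OF bounded_linear_vec_nth] assms] .
  moreover have "(\<Sum>j\<in>UNIV. (if j = l then A else 0) * v $ j + (if j = l then B else 0) * cnj (v $ j)) =
      (\<Sum>j\<in>UNIV. if j = l then A * v $ l + B * cnj (v $ l) else 0)" for v :: "complex ^ 'a"
    by (rule sum.cong) auto
  ultimately show ?thesis by (simp add: has_wirtinger_def)
qed

text \<open>Existence of the mixed second derivatives \<open>c\<close> at \<open>p\<close> is part of the notion; this makes it
closed under sums, which a condition on \<open>levi_form\<close> alone would not be, since that is
meaningless for functions that are not differentiable.\<close>

definition levi_nonneg_at :: "(complex ^ 'n \<Rightarrow> complex) \<Rightarrow> complex ^ 'n \<Rightarrow> bool" where
  "levi_nonneg_at f p \<longleftrightarrow>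
     (\<exists>V a b c e. open V \<and> p \<in> V \<and> (\<forall>x\<in>V. has_wirtinger f (a x) (b x) x) \<and>
        (\<forall>k. has_wirtinger (\<lambda>x. b x k) (\<lambda>j. c j k) (e k) p) \<and>
        (\<forall>w. 0 \<le> Re (\<Sum>j\<in>UNIV. \<Sum>k\<in>UNIV. c j k * w $ j * cnj (w $ k))))"

lemma levi_nonneg_atI:
  assumes "open V" "p \<in> V" "\<And>x. x \<in> V \<Longrightarrow> has_wirtinger f (a x) (b x) x"
    and "\<And>k. has_wirtinger (\<lambda>x. b x k) (\<lambda>j. c j k) (e k) p"
    and "\<And>w. 0 \<le> Re (\<Sum>j\<in>UNIV. \<Sum>k\<in>UNIV. c j k * w $ j * cnj (w $ k))"
  shows "levi_nonneg_at f p"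
  unfolding levi_nonneg_at_def
  by (rule exI[of _ V], rule exI[of _ a], rule exI[of _ b], rule exI[of _ c], rule exI[of _ e])
    (intro conjI ballI allI assms)

text \<open>The link to \<open>levi_form\<close>: by uniqueness of derivatives, the coefficients \<open>c\<close> are those that
\<open>levi_form\<close> computes.\<close>

lemma levi_form_nonneg:
  assumes "levi_nonneg_at (\<lambda>z. complex_of_real (\<rho> z)) p"
  shows "0 \<le> Re (levi_form \<rho> p w)"
proof -
  let ?f = "\<lambda>z. complex_of_real (\<rho> z)"
  obtain V a b c e where V [rule_format]: "open V" "p \<in> V" "\<forall>x\<in>V. has_wirtinger ?f (a x) (b x) x"
    and c [rule_format]: "\<forall>k. has_wirtinger (\<lambda>x. b x k) (\<lambda>j. c j k) (e k) p"
    and nn [rule_format]: "\<forall>w. 0 \<le> Re (\<Sum>j\<in>UNIV. \<Sum>k\<in>UNIV. c j k * w $ j * cnj (w $ k))"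
    using assms unfolding levi_nonneg_at_def by (elim exE conjE)
  have "has_wirtinger (d_zbar k ?f) (\<lambda>j. c j k) (e k) p" for k
    by (rule has_wirtinger_cong[OF V(1,2) _ c]) (simp add: d_zbar_eq[OF V(3)])
  then have "d_z j (d_zbar k ?f) p = c j k" for j k by (rule d_z_eq)
  with nn[of w] show ?thesis by (simp add: levi_form_def)
qed

lemma levi_nonneg_at_cong:
  assumes "levi_nonneg_at f p" "open V" "p \<in> V" "\<And>x. x \<in> V \<Longrightarrow> f x = g x"
  shows "levi_nonneg_at g p"
proof -
  obtain W a b c e where W [rule_format]: "open W" "p \<in> W" "\<forall>x\<in>W. has_wirtinger f (a x) (b x) x"
    and c [rule_format]: "\<forall>k. has_wirtinger (\<lambda>x. b x k) (\<lambda>j. c j k) (e k) p"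
    and nn [rule_format]: "\<forall>w. 0 \<le> Re (\<Sum>j\<in>UNIV. \<Sum>k\<in>UNIV. c j k * w $ j * cnj (w $ k))"
    using assms(1) unfolding levi_nonneg_at_def by (elim exE conjE)
  have "has_wirtinger g (a x) (b x) x" if "x \<in> V \<inter> W" for x
    using that by (intro has_wirtinger_cong[OF assms(2) _ assms(4) W(3)]) auto
  then show ?thesis
    using assms(2,3) W(1,2) by (intro levi_nonneg_atI[OF _ _ _ c nn, of "V \<inter> W"]) auto
qed

lemma levi_nonneg_at_const: "levi_nonneg_at (\<lambda>_. c) p"
  by (rule levi_nonneg_atI[OF open_UNIV UNIV_I has_wirtinger_const has_wirtinger_const]) simp

lemma levi_nonneg_at_add:
  assumes "levi_nonneg_at f p" "levi_nonneg_at g p"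
  shows "levi_nonneg_at (\<lambda>x. f x + g x) p"
proof -
  obtain V a b c e where V [rule_format]: "open V" "p \<in> V" "\<forall>x\<in>V. has_wirtinger f (a x) (b x) x"
    and c [rule_format]: "\<forall>k. has_wirtinger (\<lambda>x. b x k) (\<lambda>j. c j k) (e k) p"
    and nn [rule_format]: "\<forall>w. 0 \<le> Re (\<Sum>j\<in>UNIV. \<Sum>k\<in>UNIV. c j k * w $ j * cnj (w $ k))"
    using assms(1) unfolding levi_nonneg_at_def by (elim exE conjE)
  obtain V' a' b' c' e' where V' [rule_format]: "open V'" "p \<in> V'" "\<forall>x\<in>V'. has_wirtinger g (a' x) (b' x) x"
    and c' [rule_format]: "\<forall>k. has_wirtinger (\<lambda>x. b' x k) (\<lambda>j. c' j k) (e' k) p"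
    and nn' [rule_format]: "\<forall>w. 0 \<le> Re (\<Sum>j\<in>UNIV. \<Sum>k\<in>UNIV. c' j k * w $ j * cnj (w $ k))"
    using assms(2) unfolding levi_nonneg_at_def by (elim exE conjE)
  have 1: "has_wirtinger (\<lambda>x. f x + g x) (\<lambda>j. a x j + a' x j) (\<lambda>j. b x j + b' x j) x" if "x \<in> V \<inter> V'" for x
    using that by (intro has_wirtinger_add V(3) V'(3)) auto
  have 2: "has_wirtinger (\<lambda>x. b x k + b' x k) (\<lambda>j. c j k + c' j k) (\<lambda>j. e k j + e' k j) p" for k
    by (intro has_wirtinger_add c c')
  have "0 \<le> Re (\<Sum>j\<in>UNIV. \<Sum>k\<in>UNIV. (c j k + c' j k) * w $ j * cnj (w $ k))" for w
    using add_nonneg_nonneg[OF nn[of w] nn'[of w]]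
    by (simp only: distrib_right sum.distrib plus_complex.simps)
  from levi_nonneg_atI[OF open_Int[OF V(1) V'(1)] IntI[OF V(2) V'(2)] 1 2 this]
  show ?thesis .
qed

lemma levi_nonneg_at_sum:
  assumes "\<And>i. i \<in> I \<Longrightarrow> levi_nonneg_at (f i) p"
  shows "levi_nonneg_at (\<lambda>x. \<Sum>i\<in>I. f i x) p"
  using assms
proof (induction I rule: infinite_finite_induct)
  case (insert i I)
  have "levi_nonneg_at (\<lambda>x. f i x + (\<Sum>i\<in>I. f i x)) p"
    by (rule levi_nonneg_at_add[OF insert.prems[OF insertI1] insert.IH[OF insert.prems[OF insertI2]]])
  then show ?case using insert.hyps by simp
qed (simp_all add: levi_nonneg_at_const)

text \<open>Holomorphic near \<open>p\<close>, with first derivatives complex differentiable at \<open>p\<close>. The second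
half follows from the first by Cauchy's integral formula, but for the explicit functions used here it is
simply inherited through the product rule.\<close>

definition holo_at :: "(complex ^ 'n \<Rightarrow> complex) \<Rightarrow> complex ^ 'n \<Rightarrow> bool" where
  "holo_at h p \<longleftrightarrow>
     (\<exists>V a. open V \<and> p \<in> V \<and> (\<forall>x\<in>V. has_wirtinger h (a x) (\<lambda>_. 0) x) \<and>
        (\<forall>k. \<exists>c. has_wirtinger (\<lambda>x. a x k) c (\<lambda>_. 0) p))"

lemma holo_atI:
  assumes "open V" "p \<in> V" "\<And>x. x \<in> V \<Longrightarrow> has_wirtinger h (a x) (\<lambda>_. 0) x"
    and "\<And>k. \<exists>c. has_wirtinger (\<lambda>x. a x k) c (\<lambda>_. 0) p"
  shows "holo_at h p"
  unfolding holo_at_def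
  by (rule exI[of _ V], rule exI[of _ a]) (intro conjI ballI allI assms)

lemma holo_at_iff:
  "holo_at h p \<longleftrightarrow>
     (\<exists>V a c. open V \<and> p \<in> V \<and> (\<forall>x\<in>V. has_wirtinger h (a x) (\<lambda>_. 0) x) \<and>
        (\<forall>k. has_wirtinger (\<lambda>x. a x k) (c k) (\<lambda>_. 0) p))"
  unfolding holo_at_def choice_iff by blast

lemma holo_at_const: "holo_at (\<lambda>_. c) p"
  by (rule holo_atI[OF open_UNIV UNIV_I has_wirtinger_const exI]) (rule has_wirtinger_const)

lemma holo_at_coordinate:
  assumes "open V" "p $ l \<in> V"
    and "\<And>x. x \<in> V \<Longrightarrow> (\<phi> has_field_derivative \<phi>' x) (at x)"
    and "(\<phi>' has_field_derivative D) (at (p $ l))"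
  shows "holo_at (\<lambda>x. \<phi> (x $ l)) p"
proof -
  have wirt: "has_wirtinger (\<lambda>x. \<psi> (x $ l)) (\<lambda>j. if j = l then A else 0) (\<lambda>_. 0) q"
    if "(\<psi> has_field_derivative A) (at (q $ l))" for \<psi> A and q :: "complex ^ 'a"
    using has_wirtinger_coordinate[of \<psi> A 0 q l] that by (simp add: has_field_derivative_def)
  have op: "open {x :: complex ^ 'a. x $ l \<in> V}"
    using open_vimage_vec_nth[OF assms(1), of l] by (simp add: vimage_def)
  have 1: "has_wirtinger (\<lambda>x. \<phi> (x $ l)) (\<lambda>j. if j = l then \<phi>' (x $ l) else 0) (\<lambda>_. 0) x"
    if "x \<in> {x. x $ l \<in> V}" for x
    using that by (intro wirt assms(3)) simp
  have 2: "\<exists>c. has_wirtinger (\<lambda>x. if k = l then \<phi>' (x $ l) else 0) c (\<lambda>_. 0) p" for k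
  proof (cases "k = l")
    case True
    then show ?thesis unfolding if_P[OF True] using wirt[OF assms(4)] by (intro exI)
  next
    case False
    then show ?thesis unfolding if_not_P[OF False] using has_wirtinger_const by (intro exI)
  qed
  have "p \<in> {x. x $ l \<in> V}" using assms(2) by simp
  from holo_atI[OF op this 1 2] show ?thesis .
qed

lemma holo_at_component: "holo_at (\<lambda>x. x $ l) p"
  by (rule holo_at_coordinate[where V = UNIV and \<phi>' = "\<lambda>_. 1" and D = 0]) auto

lemma holo_at_mult:
  assumes "holo_at f p" "holo_at g p"
  shows "holo_at (\<lambda>x. f x * g x) p"
proof -
  obtain V a c where V [rule_format]: "open V" "p \<in> V" "\<forall>x\<in>V. has_wirtinger f (a x) (\<lambda>_. 0) x"
    and c [rule_format]: "\<forall>k. has_wirtinger (\<lambda>x. a x k) (c k) (\<lambda>_. 0) p"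
    using assms(1) unfolding holo_at_iff by (elim exE conjE)
  obtain W b d where W [rule_format]: "open W" "p \<in> W" "\<forall>x\<in>W. has_wirtinger g (b x) (\<lambda>_. 0) x"
    and d [rule_format]: "\<forall>k. has_wirtinger (\<lambda>x. b x k) (d k) (\<lambda>_. 0) p"
    using assms(2) unfolding holo_at_iff by (elim exE conjE)
  have 1: "has_wirtinger (\<lambda>x. f x * g x) (\<lambda>j. f x * b x j + a x j * g x) (\<lambda>_. 0) x" if "x \<in> V \<inter> W" for x
    using has_wirtinger_mult[OF V(3) W(3)] that by simp
  have 2: "\<exists>c. has_wirtinger (\<lambda>x. f x * b x k + a x k * g x) c (\<lambda>_. 0) p" for k
    using has_wirtinger_add[OF has_wirtinger_mult[OF V(3)[OF V(2)] d]
        has_wirtinger_mult[OF c W(3)[OF W(2)]], of k k] by (auto simp only: mult_zero_right mult_zero_left add_0)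
  show ?thesis
    by (rule holo_atI[OF open_Int[OF V(1) W(1)] IntI[OF V(2) W(2)] 1 2])
qed

text \<open>The $\bar z_k$-derivative of \<open>h + cnj h\<close> is the conjugate of a holomorphic function, so its
$z_j$-derivatives vanish.\<close>

lemma levi_nonneg_at_pluriharmonic:
  assumes "holo_at h p"
  shows "levi_nonneg_at (\<lambda>x. h x + cnj (h x)) p"
proof -
  obtain V a c where V [rule_format]: "open V" "p \<in> V" "\<forall>x\<in>V. has_wirtinger h (a x) (\<lambda>_. 0) x"
    and c [rule_format]: "\<forall>k. has_wirtinger (\<lambda>x. a x k) (c k) (\<lambda>_. 0) p"
    using assms unfolding holo_at_iff by (elim exE conjE)
  have 1: "has_wirtinger (\<lambda>x. h x + cnj (h x)) (a x) (\<lambda>j. cnj (a x j)) x" if "x \<in> V" for x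
    using has_wirtinger_add[OF V(3) has_wirtinger_cnj[OF V(3)]] that by simp
  have 2: "has_wirtinger (\<lambda>x. cnj (a x k)) (\<lambda>_. 0) (\<lambda>j. cnj (c k j)) p" for k
    using has_wirtinger_cnj[OF c] by simp
  have "0 \<le> Re (\<Sum>j\<in>UNIV. \<Sum>k\<in>UNIV. 0 * w $ j * cnj (w $ k))" for w :: "complex ^ 'a"
    by simp
  from levi_nonneg_atI[OF V(1,2) 1 2 this] show ?thesis .
qed

text \<open>The Levi form of \<open>\<bar>h\<bar>\<^sup>2\<close> in the direction \<open>w\<close> is \<open>\<bar>\<Sum>j. a p j * w $ j\<bar>\<^sup>2\<close>.\<close>

lemma levi_nonneg_at_norm_square:
  assumes "holo_at h p"
  shows "levi_nonneg_at (\<lambda>x. h x * cnj (h x)) p"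
proof -
  obtain V a c where V [rule_format]: "open V" "p \<in> V" "\<forall>x\<in>V. has_wirtinger h (a x) (\<lambda>_. 0) x"
    and c [rule_format]: "\<forall>k. has_wirtinger (\<lambda>x. a x k) (c k) (\<lambda>_. 0) p"
    using assms unfolding holo_at_iff by (elim exE conjE)
  have 1: "has_wirtinger (\<lambda>x. h x * cnj (h x)) (\<lambda>j. a x j * cnj (h x)) (\<lambda>j. h x * cnj (a x j)) x"
    if "x \<in> V" for x
    using has_wirtinger_mult[OF V(3) has_wirtinger_cnj[OF V(3)]] that by simp
  have 2: "has_wirtinger (\<lambda>x. h x * cnj (a x k)) (\<lambda>j. a p j * cnj (a p k)) (\<lambda>j. h p * cnj (c k j)) p" for k
    using has_wirtinger_mult[OF V(3)[OF V(2)] has_wirtinger_cnj[OF c]] by simp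
  have "0 \<le> Re (\<Sum>j\<in>UNIV. \<Sum>k\<in>UNIV. a p j * cnj (a p k) * w $ j * cnj (w $ k))" for w
  proof -
    have "(\<Sum>j\<in>UNIV. \<Sum>k\<in>UNIV. a p j * cnj (a p k) * w $ j * cnj (w $ k)) =
        (\<Sum>j\<in>UNIV. a p j * w $ j) * cnj (\<Sum>j\<in>UNIV. a p j * w $ j)"
      by (simp add: sum_product mult_ac)
    then show ?thesis by (simp only: complex_mult_cnj Re_complex_of_real) simp
  qed
  from levi_nonneg_atI[OF V(1,2) 1 2 this] show ?thesis .
qed

text \<open>For a function of a single coordinate the only mixed derivative is \<open>C\<close>, a quarter of the
Laplacian in that coordinate.\<close>

lemma levi_nonneg_at_coordinate:
  assumes "open V" "p $ l \<in> V"
    and "\<And>x. x \<in> V \<Longrightarrow> (\<phi> has_derivative (\<lambda>v. A x * v + B x * cnj v)) (at x)"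
    and "(B has_derivative (\<lambda>v. C * v + D * cnj v)) (at (p $ l))"
    and "0 \<le> Re C"
  shows "levi_nonneg_at (\<lambda>x. \<phi> (x $ l)) p"
proof -
  have op: "open {x :: complex ^ 'a. x $ l \<in> V}"
    using open_vimage_vec_nth[OF assms(1), of l] by (simp add: vimage_def)
  have 1: "has_wirtinger (\<lambda>x. \<phi> (x $ l)) (\<lambda>j. if j = l then A (x $ l) else 0)
      (\<lambda>j. if j = l then B (x $ l) else 0) x" if "x \<in> {x. x $ l \<in> V}" for x
    using that by (intro has_wirtinger_coordinate assms(3)) simp
  have 2: "has_wirtinger (\<lambda>x. if k = l then B (x $ l) else 0) (\<lambda>j. if k = l \<and> j = l then C else 0)
      (\<lambda>j. if k = l \<and> j = l then D else 0) p" for k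
  proof (cases "k = l")
    case True
    then show ?thesis using has_wirtinger_coordinate[OF assms(4)] by simp
  next
    case False
    then show ?thesis using has_wirtinger_const[of 0 p] by simp
  qed
  have nn: "0 \<le> Re (\<Sum>j\<in>UNIV. \<Sum>k\<in>UNIV. (if k = l \<and> j = l then C else 0) * w $ j * cnj (w $ k))" for w
  proof -
    have "(\<Sum>k\<in>UNIV. (if k = l \<and> j = l then C else 0) * w $ j * cnj (w $ k)) =
        (if j = l then C * (w $ l * cnj (w $ l)) else 0)" for j
    proof -
      have "(\<Sum>k\<in>UNIV. (if k = l \<and> j = l then C else 0) * w $ j * cnj (w $ k)) =
        (\<Sum>k\<in>UNIV. if k = l then (if j = l then C * (w $ l * cnj (w $ l)) else 0) else 0)"
        by (rule sum.cong) auto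
      then show ?thesis by simp
    qed
    then have "(\<Sum>j\<in>UNIV. \<Sum>k\<in>UNIV. (if k = l \<and> j = l then C else 0) * w $ j * cnj (w $ k)) =
        C * of_real ((cmod (w $ l))\<^sup>2)"
      by (simp only: complex_norm_square) simp
    then show ?thesis using assms(5) by simp
  qed
  have "p \<in> {x. x $ l \<in> V}" using assms(2) by simp
  from levi_nonneg_atI[OF op this 1 2 nn] show ?thesis .
qed

text \<open>The same calculus in one complex variable, for functions of the last coordinate.\<close>

lemma wirtinger1_mult:
  assumes "(f has_derivative (\<lambda>v. A * v + B * cnj v)) (at x)"
    and "(g has_derivative (\<lambda>v. C * v + D * cnj v)) (at x)"
  shows "((\<lambda>x. f x * g x) has_derivative (\<lambda>v. (f x * C + A * g x) * v + (f x * D + B * g x) * cnj v)) (at x)"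
  using has_derivative_mult[OF assms] by (simp add: algebra_simps)

lemma wirtinger1_add:
  assumes "(f has_derivative (\<lambda>v. A * v + B * cnj v)) (at x)"
    and "(g has_derivative (\<lambda>v. C * v + D * cnj v)) (at x)"
  shows "((\<lambda>x. f x + g x) has_derivative (\<lambda>v. (A + C) * v + (B + D) * cnj v)) (at x)"
  using has_derivative_add[OF assms] by (simp add: algebra_simps)

lemma wirtinger1_cnj:
  assumes "(f has_derivative (\<lambda>v. A * v + B * cnj v)) (at x)"
  shows "((\<lambda>x. cnj (f x)) has_derivative (\<lambda>v. cnj B * v + cnj A * cnj v)) (at x)"
  using has_derivative_cnj[OF assms] by (simp add: algebra_simps)

lemma wirtinger1_holomorphic:
  assumes "(f has_field_derivative A) (at x)"
  shows "(f has_derivative (\<lambda>v. A * v + 0 * cnj v)) (at x)"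
  using assms by (simp add: has_field_derivative_def)

text \<open>The Wirtinger derivatives of \<open>\<bar>x\<bar>\<^sup>2 = x * cnj x\<close> are \<open>cnj x\<close> and \<open>x\<close>.\<close>

lemma wirtinger1_radial:
  assumes "(h has_real_derivative d) (at ((cmod x)\<^sup>2))"
  shows "((\<lambda>x. complex_of_real (h ((cmod x)\<^sup>2))) has_derivative
    (\<lambda>v. (of_real d * cnj x) * v + (of_real d * x) * cnj v)) (at x)"
proof -
  have "((\<lambda>x. Re x * Re x + Im x * Im x) has_derivative
      (\<lambda>v. Re x * Re v + Re v * Re x + (Im x * Im v + Im v * Im x))) (at x)"
    by (intro has_derivative_add has_derivative_mult bounded_linear_imp_has_derivative
        bounded_linear_Re bounded_linear_Im)
  moreover have "(\<lambda>x. Re x * Re x + Im x * Im x) = (\<lambda>x. (cmod x)\<^sup>2)"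
    unfolding cmod_power2 by (simp add: power2_eq_square)
  ultimately have "((\<lambda>x. (cmod x)\<^sup>2) has_derivative
      (\<lambda>v. Re x * Re v + Re v * Re x + (Im x * Im v + Im v * Im x))) (at x)"
    by simp
  from has_derivative_of_real[OF has_derivative_compose[OF this assms[unfolded has_field_derivative_def]]]
  show ?thesis
    by (rule has_derivative_eq_rhs) (auto simp: complex_eq_iff algebra_simps)
qed

section \<open>The cut-off terms of the defining function\<close>

text \<open>The two cut-off terms as one function of \<open>\<tau> = \<bar>w\<bar>\<^sup>2\<close>. It vanishes for \<open>1 \<le> \<tau> \<le> \<beta>\<^sup>2\<close>, and its
two summands are never positive simultaneously when \<open>\<beta> > 1\<close>. The two further functions are its
first two derivatives.\<close>

definition wall :: "real \<Rightarrow> real \<Rightarrow> real \<Rightarrow> real" where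
  "wall \<beta> M \<tau> = M * flat 0 (\<tau> - \<beta>\<^sup>2) + M * flat 0 (1 - \<tau>)"

definition wall' :: "real \<Rightarrow> real \<Rightarrow> real \<Rightarrow> real" where
  "wall' \<beta> M \<tau> = M * flat 2 (\<tau> - \<beta>\<^sup>2) - M * flat 2 (1 - \<tau>)"

definition wall'' :: "real \<Rightarrow> real \<Rightarrow> real \<Rightarrow> real" where
  "wall'' \<beta> M \<tau> = M * (flat 4 (\<tau> - \<beta>\<^sup>2) - 2 * flat 3 (\<tau> - \<beta>\<^sup>2))
     + M * (flat 4 (1 - \<tau>) - 2 * flat 3 (1 - \<tau>))"

lemma flat_shift_derivatives:
  "((\<lambda>\<tau>. flat m (\<tau> - c)) has_real_derivative flat (m + 2) (\<tau> - c) - m * flat (m + 1) (\<tau> - c)) (at \<tau>)"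
  "((\<lambda>\<tau>. flat m (c - \<tau>)) has_real_derivative - (flat (m + 2) (c - \<tau>) - m * flat (m + 1) (c - \<tau>))) (at \<tau>)"
proof -
  have "((\<lambda>\<tau>. \<tau> - c) has_real_derivative 1) (at \<tau>)" "((\<lambda>\<tau>. c - \<tau>) has_real_derivative - 1) (at \<tau>)"
    by (auto intro!: derivative_eq_intros)
  from DERIV_chain2[OF flat_has_derivative this(1)] DERIV_chain2[OF flat_has_derivative this(2)]
  show "((\<lambda>\<tau>. flat m (\<tau> - c)) has_real_derivative flat (m + 2) (\<tau> - c) - m * flat (m + 1) (\<tau> - c)) (at \<tau>)"
    "((\<lambda>\<tau>. flat m (c - \<tau>)) has_real_derivative - (flat (m + 2) (c - \<tau>) - m * flat (m + 1) (c - \<tau>))) (at \<tau>)"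
    by simp_all
qed

lemma wall_has_derivative: "(wall \<beta> M has_real_derivative wall' \<beta> M \<tau>) (at \<tau>)"
  using DERIV_add[OF DERIV_cmult[OF flat_shift_derivatives(1)[of 0], of M]
      DERIV_cmult[OF flat_shift_derivatives(2)[of 0], of M], of "\<beta>\<^sup>2" 1 \<tau>]
  by (simp add: wall_def[abs_def] wall'_def numeral_2_eq_2)

lemma wall'_has_derivative: "(wall' \<beta> M has_real_derivative wall'' \<beta> M \<tau>) (at \<tau>)"
  using DERIV_diff[OF DERIV_cmult[OF flat_shift_derivatives(1)[of 2], of M]
      DERIV_cmult[OF flat_shift_derivatives(2)[of 2], of M], of "\<beta>\<^sup>2" 1 \<tau>]
  by (simp add: wall'_def[abs_def] wall''_def numeral_eq_Suc algebra_simps)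

lemma flat_nonneg: "flat m t \<ge> 0"
  by (simp add: flat_def)

lemma wall_nonneg: "M \<ge> 0 \<Longrightarrow> 0 \<le> wall \<beta> M \<tau>"
  by (simp add: wall_def flat_nonneg)

text \<open>\<open>M * exp (- 1 / t)\<close> is increasing in \<open>t\<close>, and it is at least \<open>1\<close> for \<open>t = 1 / 3\<close>.\<close>

lemma flat_small:
  assumes "M \<ge> exp 3" "M * flat 0 t \<le> 1"
  shows "t \<le> 1 / 3"
proof (rule ccontr)
  assume t: "\<not> t \<le> 1 / 3"
  then have "exp (- 3) < exp (- 1 / t)"
    by (simp add: field_simps)
  then have "exp 3 * exp (- 3) < M * exp (- 1 / t)"
    using assms(1) by (intro mult_le_less_imp_less) auto
  with assms(2) t show False by (simp add: flat_def flip: exp_add)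
qed

lemma wall_small:
  assumes "M \<ge> exp 3" "wall \<beta> M \<tau> \<le> 1"
  shows "\<tau> - \<beta>\<^sup>2 \<le> 1 / 3" "1 - \<tau> \<le> 1 / 3"
proof -
  have "0 \<le> M" using assms(1) exp_gt_zero[of "3::real"] by linarith
  then have "0 \<le> M * flat 0 (\<tau> - \<beta>\<^sup>2)" "0 \<le> M * flat 0 (1 - \<tau>)"
    by (simp_all add: flat_nonneg)
  with assms(2) have "M * flat 0 (\<tau> - \<beta>\<^sup>2) \<le> 1" "M * flat 0 (1 - \<tau>) \<le> 1"
    unfolding wall_def by linarith+
  then show "\<tau> - \<beta>\<^sup>2 \<le> 1 / 3" "1 - \<tau> \<le> 1 / 3"
    by (auto simp only: wall_def intro!: flat_small[OF assms(1)])
qed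

text \<open>The quantity is a quarter of the Laplacian of \<open>wall \<beta> M (\<bar>w\<bar>\<^sup>2)\<close> at \<open>\<bar>w\<bar>\<^sup>2 = \<tau>\<close>. With
\<open>s = \<tau> - \<beta>\<^sup>2\<close> and \<open>t = 1 - \<tau>\<close> it is \<open>M\<close> times
\<open>flat 4 s * (s\<^sup>2 + \<tau> * (1 - 2 * s)) + flat 4 t * (1 - 3 * t + t\<^sup>2)\<close>, and both brackets are
non-negative for \<open>s, t \<le> 1 / 3\<close>.\<close>

lemma wall_subharmonic:
  assumes "M \<ge> 0" "\<tau> > 0" "\<tau> - \<beta>\<^sup>2 \<le> 1 / 3" "1 - \<tau> \<le> 1 / 3"
  shows "0 \<le> wall' \<beta> M \<tau> + \<tau> * wall'' \<beta> M \<tau>"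
proof -
  have f2: "flat 2 t = t\<^sup>2 * flat 4 t" and f3: "flat 3 t = t * flat 4 t" for t
    by (auto simp: flat_def field_simps power2_eq_square eval_nat_numeral)
  define s where "s = \<tau> - \<beta>\<^sup>2"
  define t where "t = 1 - \<tau>"
  have "0 \<le> flat 4 s * (s\<^sup>2 + \<tau> * (1 - 2 * s))"
    using assms by (intro mult_nonneg_nonneg add_nonneg_nonneg flat_nonneg) (auto simp: s_def)
  moreover have "0 \<le> flat 4 t * (1 - 3 * t + t\<^sup>2)"
    using assms by (intro mult_nonneg_nonneg add_nonneg_nonneg flat_nonneg) (auto simp: t_def)
  moreover have "wall' \<beta> M \<tau> + \<tau> * wall'' \<beta> M \<tau> =
      M * (flat 4 s * (s\<^sup>2 + \<tau> * (1 - 2 * s)) + flat 4 t * (1 - 3 * t + t\<^sup>2))"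
  proof -
    have "\<tau> = 1 - t" by (simp add: t_def)
    then have "flat 4 t * (1 - 3 * t + t\<^sup>2) = - flat 2 t + \<tau> * (flat 4 t - 2 * flat 3 t)"
      unfolding \<open>\<tau> = 1 - t\<close> f2 f3 by (simp add: algebra_simps power2_eq_square)
    moreover have "flat 4 s * (s\<^sup>2 + \<tau> * (1 - 2 * s)) = flat 2 s + \<tau> * (flat 4 s - 2 * flat 3 s)"
      by (simp add: f2 f3 algebra_simps)
    moreover have "wall' \<beta> M \<tau> + \<tau> * wall'' \<beta> M \<tau> = M * ((flat 2 s + \<tau> * (flat 4 s - 2 * flat 3 s))
        + (- flat 2 t + \<tau> * (flat 4 t - 2 * flat 3 t)))"
      unfolding wall'_def wall''_def s_def[symmetric] t_def[symmetric] by (simp add: algebra_simps)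
    ultimately show ?thesis by simp
  qed
  ultimately show ?thesis using assms(1) by simp
qed

text \<open>The derivative of \<open>wall\<close> can only vanish where both cut-off terms do, since otherwise exactly one
of them is present and it is strictly monotone there.\<close>

lemma wall'_neq_0:
  assumes "M > 0" "\<beta> > 1" "wall \<beta> M \<tau> > 0"
  shows "wall' \<beta> M \<tau> \<noteq> 0"
proof -
  have b: "\<beta>\<^sup>2 > 1" using assms(2) by simp
  consider "\<tau> > \<beta>\<^sup>2" | "\<tau> < 1" | "1 \<le> \<tau>" "\<tau> \<le> \<beta>\<^sup>2" by linarith
  then show ?thesis
  proof cases
    case 1
    then show ?thesis using b flat_pos[of "\<tau> - \<beta>\<^sup>2" 2] assms(1) by (simp add: wall'_def)
  next
    case 2
    then show ?thesis using b flat_pos[of "1 - \<tau>" 2] assms(1) by (simp add: wall'_def)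
  next
    case 3
    then show ?thesis using assms(3) by (simp add: wall_def)
  qed
qed

section \<open>Smoothness of the defining function\<close>

definition phase :: "real \<Rightarrow> complex \<Rightarrow> complex" where
  "phase \<alpha> w = exp (2 * \<i> * complex_of_real \<alpha> * complex_of_real (ln (cmod w)))"

lemma phase_eq_cis: "phase \<alpha> w = cis (2 * \<alpha> * ln (cmod w))"
  by (simp add: phase_def cis_conv_exp mult_ac)

lemma worm_r_eq:
  "worm_r \<alpha> \<beta> M z = (cmod (z $ first_index - phase \<alpha> (z $ last_index)))\<^sup>2
     + (\<Sum>j \<in> UNIV - {first_index, last_index}. (cmod (z $ j))\<^sup>2)
     + wall \<beta> M ((cmod (z $ last_index))\<^sup>2) - 1"
  by (simp add: worm_r_def Let_def phase_def wall_def \<sigma>_eq_flat)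

lemma open_last_nonzero: "open {z :: complex ^ 'n. z $ l \<noteq> 0}"
  by (intro open_Collect_neq continuous_intros)

lemma smooth_worm_r:
  "Ck_on k {z :: complex ^ 'n::{finite,linorder}. z $ last_index \<noteq> 0} (worm_r \<alpha> \<beta> M)"
proof -
  let ?S = "{z :: complex ^ 'n::{finite,linorder}. z $ last_index \<noteq> 0}"
  note op = open_last_nonzero[of last_index]
  define nsq where "nsq j z = Re (z $ j) * Re (z $ j) + Im (z $ j) * Im (z $ j)"
    for j and z :: "complex ^ 'n::{finite,linorder}"
  define \<theta> where "\<theta> z = \<alpha> * ln (nsq last_index z)" for z
  note minus1 = Ck_on_mult[OF op Ck_on_const[OF op, of k "-1"]]
  have nsq: "nsq j z = (cmod (z $ j))\<^sup>2" for j z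
    unfolding cmod_power2 by (simp add: nsq_def power2_eq_square)
  have sn: "Ck_on k ?S (nsq j)" for j
    unfolding nsq_def by (intro Ck_on_add Ck_on_mult Ck_on_Re_Im_component op)
  have s\<theta>: "Ck_on k ?S \<theta>"
    unfolding \<theta>_def by (intro Ck_on_mult Ck_on_const Ck_on_ln op sn) (simp add: nsq)
  define u where "u z = Re (z $ first_index) + (-1) * cos (\<theta> z)" for z :: "complex ^ 'n::{finite,linorder}"
  define v where "v z = Im (z $ first_index) + (-1) * sin (\<theta> z)" for z :: "complex ^ 'n::{finite,linorder}"
  have su: "Ck_on k ?S u" and sv: "Ck_on k ?S v" unfolding u_def v_def
    by (intro Ck_on_add minus1 Ck_on_Re_Im_component op Ck_on_sin_cos[OF op s\<theta>, THEN conjunct1]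
        Ck_on_sin_cos[OF op s\<theta>, THEN conjunct2])+
  have sw: "Ck_on k ?S (\<lambda>z. M * flat 0 (nsq last_index z + (- (\<beta>\<^sup>2))) + M * flat 0 (1 + (-1) * nsq last_index z))"
    by (intro Ck_on_add Ck_on_mult[OF op Ck_on_const[OF op]] Ck_on_flat Ck_on_const minus1 op sn)
  have smooth: "Ck_on k ?S (\<lambda>z. u z * u z + v z * v z
      + (\<Sum>j \<in> UNIV - {first_index, last_index}. nsq j z)
      + (M * flat 0 (nsq last_index z + (- (\<beta>\<^sup>2))) + M * flat 0 (1 + (-1) * nsq last_index z)) + (- 1))"
    by (intro Ck_on_add[OF op] Ck_on_mult[OF op su su] Ck_on_mult[OF op sv sv] Ck_on_sum sn sw Ck_on_const op)
  have eq: "u z * u z + v z * v z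
      + (\<Sum>j \<in> UNIV - {first_index, last_index}. nsq j z)
      + (M * flat 0 (nsq last_index z + (- (\<beta>\<^sup>2))) + M * flat 0 (1 + (-1) * nsq last_index z)) + (- 1)
      = worm_r \<alpha> \<beta> M z" if "z \<in> ?S" for z
  proof -
    have "\<theta> z = 2 * \<alpha> * ln (cmod (z $ last_index))"
      using that by (simp add: \<theta>_def nsq ln_realpow)
    then have "u z = Re (z $ first_index - phase \<alpha> (z $ last_index))"
      "v z = Im (z $ first_index - phase \<alpha> (z $ last_index))"
      by (simp_all add: u_def v_def phase_eq_cis)
    then have "u z * u z + v z * v z = (cmod (z $ first_index - phase \<alpha> (z $ last_index)))\<^sup>2"
      unfolding cmod_power2 by (simp only: power2_eq_square)
    then show ?thesis by (simp add: worm_r_eq wall_def nsq)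
  qed
  show ?thesis by (rule Ck_on_cong[OF op eq, THEN iffD1, OF _ smooth])
qed

section \<open>A holomorphic power that untwists the worm\<close>

text \<open>A branch of \<open>w powr (- \<i> * \<alpha>)\<close> on the half plane around \<open>q\<close>. The principal logarithm is taken of
\<open>w * cnj q\<close>, so that its cut is opposite to \<open>q\<close>; the constant \<open>ln \<bar>q\<bar>\<close> normalises
the real part to \<open>ln \<bar>w\<bar>\<close>, and this makes \<open>twist_square\<close> hold without a constant factor.\<close>

definition twist :: "real \<Rightarrow> complex \<Rightarrow> complex \<Rightarrow> complex" where
  "twist \<alpha> q w = exp (- \<i> * complex_of_real \<alpha> * (Ln (w * cnj q) - complex_of_real (ln (cmod q))))"

lemma halfplane_nonzero:
  assumes "Re (w * cnj q) > 0"
  shows "w \<noteq> 0" "q \<noteq> 0" "w * cnj q \<notin> \<real>\<^sub>\<le>\<^sub>0"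
  using assms by (auto simp: complex_nonpos_Reals_iff)

lemma twist_has_derivative:
  assumes "Re (w * cnj q) > 0"
  shows "(twist \<alpha> q has_field_derivative (- \<i> * complex_of_real \<alpha> / w) * twist \<alpha> q w) (at w)"
proof -
  note nz = halfplane_nonzero[OF assms]
  have "((\<lambda>w. Ln (w * cnj q)) has_field_derivative 1 / w) (at w)"
    using nz by (auto intro!: derivative_eq_intros simp: field_simps)
  then have "((\<lambda>w. - \<i> * complex_of_real \<alpha> * (Ln (w * cnj q) - complex_of_real (ln (cmod q))))
      has_field_derivative - \<i> * complex_of_real \<alpha> * (1 / w - 0)) (at w)"
    by (intro DERIV_cmult DERIV_diff DERIV_const)
  from DERIV_chain2[OF DERIV_exp this] show ?thesis
    unfolding twist_def[abs_def] by (simp add: mult_ac)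
qed

lemma twist_derivative_has_derivative:
  assumes "Re (w * cnj q) > 0"
  shows "\<exists>D. ((\<lambda>w. (- \<i> * complex_of_real \<alpha> / w) * twist \<alpha> q w) has_field_derivative D) (at w)"
proof -
  have "((\<lambda>w. - \<i> * complex_of_real \<alpha> / w) has_field_derivative \<i> * complex_of_real \<alpha> / (w * w)) (at w)"
    using halfplane_nonzero(1)[OF assms] by (auto intro!: derivative_eq_intros)
  from DERIV_mult[OF this twist_has_derivative[OF assms]] show ?thesis by (rule exI)
qed

lemma Ln_halfplane:
  assumes "Re (w * cnj q) > 0"
  shows "Ln (w * cnj q) - complex_of_real (ln (cmod q)) = Complex (ln (cmod w)) (Im (Ln (w * cnj q)))"
proof -
  have "Re (Ln (w * cnj q)) = ln (cmod w) + ln (cmod q)"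
    using halfplane_nonzero[OF assms] by (simp add: norm_mult ln_mult)
  then show ?thesis by (simp add: complex_eq_iff)
qed

lemma cmod_twist:
  assumes "Re (w * cnj q) > 0"
  shows "(cmod (twist \<alpha> q w))\<^sup>2 = exp (2 * \<alpha> * Im (Ln (w * cnj q)))"
  unfolding twist_def Ln_halfplane[OF assms] by (simp add: power2_eq_square flip: exp_add)

lemma cmod_twist_arctan:
  assumes "Re (w * cnj q) > 0"
  shows "(cmod (twist \<alpha> q w))\<^sup>2 = exp (2 * \<alpha> * arctan (Im (w * cnj q) / Re (w * cnj q)))"
  using cmod_twist[OF assms] Arg_eq_Im_Ln[of "w * cnj q"] arg_conv_arctan[OF assms] halfplane_nonzero[OF assms]
  by simp

text \<open>The identity \<open>F\<^sup>2 * exp (2 * \<i> * \<alpha> * ln \<bar>w\<bar>) = \<bar>F\<bar>\<^sup>2\<close>: in \<open>exp (- 2 * \<i> * \<alpha> * L)\<close> the factor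
coming from the real part \<open>ln \<bar>w\<bar>\<close> of the logarithm \<open>L\<close> is cancelled by the phase,
and what remains is \<open>exp (2 * \<alpha> * Im L) = \<bar>F\<bar>\<^sup>2\<close>.\<close>

lemma twist_square:
  assumes "Re (w * cnj q) > 0"
  shows "twist \<alpha> q w * twist \<alpha> q w * phase \<alpha> w = twist \<alpha> q w * cnj (twist \<alpha> q w)"
proof -
  have "twist \<alpha> q w * twist \<alpha> q w * phase \<alpha> w = exp (complex_of_real (2 * \<alpha> * Im (Ln (w * cnj q))))"
    unfolding twist_def Ln_halfplane[OF assms] phase_def
    by (simp only: exp_add[symmetric]) (rule arg_cong[of _ _ exp], simp add: complex_eq_iff algebra_simps)
  also have "\<dots> = complex_of_real ((cmod (twist \<alpha> q w))\<^sup>2)"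
    unfolding cmod_twist[OF assms] by (rule exp_of_real)
  finally show ?thesis by (simp only: complex_norm_square)
qed

section \<open>Plurisubharmonicity of the untwisted defining function\<close>

text \<open>The mixed derivative of \<open>\<bar>F\<bar>\<^sup>2 * \<lambda>(\<bar>w\<bar>\<^sup>2)\<close> is
\<open>\<bar>F\<bar>\<^sup>2 * (\<alpha>\<^sup>2 * \<lambda> / \<bar>w\<bar>\<^sup>2 + \<lambda>' + \<bar>w\<bar>\<^sup>2 * \<lambda>'')\<close>: the terms in which one derivative falls on \<open>F\<close> and the
other on \<open>\<lambda>\<close> cancel, because the logarithmic derivative \<open>c w = - \<i> * \<alpha> / w\<close> of \<open>F\<close> times \<open>w\<close> is purely
imaginary.\<close>

lemma levi_nonneg_twisted_wall:
  fixes p :: "complex ^ 'n"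
  assumes "p $ l \<noteq> 0" "0 \<le> wall \<beta> M ((cmod (p $ l))\<^sup>2)"
    "0 \<le> wall' \<beta> M ((cmod (p $ l))\<^sup>2) + (cmod (p $ l))\<^sup>2 * wall'' \<beta> M ((cmod (p $ l))\<^sup>2)"
  shows "levi_nonneg_at (\<lambda>z. twist \<alpha> (p $ l) (z $ l) * cnj (twist \<alpha> (p $ l) (z $ l)) *
    complex_of_real (wall \<beta> M ((cmod (z $ l))\<^sup>2))) p"
proof -
  define q where "q = p $ l"
  define F where "F = twist \<alpha> q"
  define N where "N w = F w * cnj (F w)" for w
  define c where "c w = - \<i> * complex_of_real \<alpha> / w" for w :: complex
  define W where "W w = complex_of_real (wall \<beta> M ((cmod w)\<^sup>2))" for w
  define W1 where "W1 w = complex_of_real (wall' \<beta> M ((cmod w)\<^sup>2))" for w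
  define W2 where "W2 w = complex_of_real (wall'' \<beta> M ((cmod w)\<^sup>2))" for w
  define V where "V = {w. Re (w * cnj q) > 0}"
  have V: "open V" unfolding V_def by (intro open_Collect_less continuous_intros)
  have qV: "q \<in> V" using assms(1) by (simp add: V_def q_def complex_neq_0 flip: power2_eq_square)
  have dF: "(F has_derivative (\<lambda>v. (c w * F w) * v + 0 * cnj v)) (at w)" if "w \<in> V" for w
    using wirtinger1_holomorphic[OF twist_has_derivative] that unfolding V_def F_def c_def by blast
  have dN: "(N has_derivative (\<lambda>v. (c w * N w) * v + (cnj (c w) * N w) * cnj v)) (at w)" if "w \<in> V" for w
    unfolding N_def
    by (rule has_derivative_eq_rhs[OF wirtinger1_mult[OF dF[OF that] wirtinger1_cnj[OF dF[OF that]]]])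
      (simp add: algebra_simps)
  have dW: "(W has_derivative (\<lambda>v. (W1 w * cnj w) * v + (W1 w * w) * cnj v)) (at w)" for w
    unfolding W_def W1_def by (rule wirtinger1_radial[OF wall_has_derivative])
  have dW1: "(W1 has_derivative (\<lambda>v. (W2 w * cnj w) * v + (W2 w * w) * cnj v)) (at w)" for w
    unfolding W1_def W2_def by (rule wirtinger1_radial[OF wall'_has_derivative])
  define B where "B w = N w * (W1 w * w + cnj (c w) * W w)" for w
  have 1: "((\<lambda>w. N w * W w) has_derivative (\<lambda>v. (N w * (W1 w * cnj w) + (c w * N w) * W w) * v
      + B w * cnj v)) (at w)" if "w \<in> V" for w
    by (rule has_derivative_eq_rhs[OF wirtinger1_mult[OF dN[OF that] dW]])
      (simp add: B_def algebra_simps)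
  have q0: "q \<noteq> 0" using assms(1) q_def by simp
  have dc: "(c has_derivative (\<lambda>v. (\<i> * complex_of_real \<alpha> / (q * q)) * v + 0 * cnj v)) (at q)"
    unfolding c_def using q0 by (intro wirtinger1_holomorphic) (auto intro!: derivative_eq_intros)
  have did: "((\<lambda>w. w) has_derivative (\<lambda>v. 1 * v + 0 * cnj v)) (at q)"
    by simp
  note dB = wirtinger1_mult[OF dN[OF qV] wirtinger1_add[OF wirtinger1_mult[OF dW1 did]
        wirtinger1_mult[OF wirtinger1_cnj[OF dc] dW]]]
  define C where "C = N q * ((W1 q * 1 + (W2 q * cnj q) * q) + (cnj (c q) * (W1 q * cnj q) + cnj 0 * W q))
      + (c q * N q) * (W1 q * q + cnj (c q) * W q)"
  obtain D where 2: "(B has_derivative (\<lambda>v. C * v + D * cnj v)) (at q)"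
    using dB unfolding B_def[abs_def] C_def by blast
  have "C = N q * (W1 q + W2 q * (q * cnj q) + (c q * cnj (c q)) * W q)"
  proof -
    \<comment> \<open>the cancellation of the mixed terms: \<open>c q * q = - \<i> * \<alpha>\<close>\<close>
    have "c q * q + cnj (c q) * cnj q = 0"
      using q0 by (simp add: c_def)
    moreover have "C = N q * (W1 q + W2 q * (q * cnj q) + (c q * cnj (c q)) * W q)
        + N q * W1 q * (c q * q + cnj (c q) * cnj q)"
      unfolding C_def by (simp add: algebra_simps)
    ultimately show ?thesis by simp
  qed
  also have "\<dots> = complex_of_real ((cmod (F q))\<^sup>2 * (wall' \<beta> M ((cmod q)\<^sup>2)
      + (cmod q)\<^sup>2 * wall'' \<beta> M ((cmod q)\<^sup>2) + (cmod (c q))\<^sup>2 * wall \<beta> M ((cmod q)\<^sup>2)))"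
    unfolding N_def W_def W1_def W2_def of_real_mult of_real_add complex_norm_square
    by (simp only: mult_ac)
  finally have "0 \<le> Re C"
    using assms(2,3) by (simp add: q_def)
  from levi_nonneg_at_coordinate[OF V qV[unfolded q_def] 1 2[unfolded q_def] this]
  show ?thesis unfolding N_def W_def F_def q_def .
qed

text \<open>After multiplication by \<open>\<bar>F\<bar>\<^sup>2\<close> the two cross terms of \<open>\<bar>z\<^sub>1 - phase\<bar>\<^sup>2\<close> turn into \<open>z\<^sub>1 * F\<^sup>2\<close>
and its conjugate by \<open>twist_square\<close>, and \<open>\<bar>phase\<bar>\<^sup>2 - 1\<close> vanishes.\<close>

lemma twisted_worm_r_eq:
  fixes z :: "complex ^ 'n::{finite,linorder}" and \<alpha> :: real
  assumes "Re (z $ last_index * cnj q) > 0" "(first_index :: 'n) \<noteq> last_index"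
  defines "F \<equiv> twist \<alpha> q (z $ last_index)"
  shows "complex_of_real ((cmod F)\<^sup>2 * worm_r \<alpha> \<beta> M z) =
    (\<Sum>j\<in>UNIV - {last_index}. (z $ j * F) * cnj (z $ j * F))
    + ((- 1) * (z $ first_index * (F * F)) + cnj ((- 1) * (z $ first_index * (F * F))))
    + F * cnj F * complex_of_real (wall \<beta> M ((cmod (z $ last_index))\<^sup>2))"
proof -
  define e where "e = phase \<alpha> (z $ last_index)"
  define z1 where "z1 = z $ first_index"
  define Q where "Q = (\<Sum>j \<in> UNIV - {first_index, last_index}. z $ j * cnj (z $ j))"
  define W where "W = complex_of_real (wall \<beta> M ((cmod (z $ last_index))\<^sup>2))"
  have ee: "e * cnj e = 1" by (simp add: e_def phase_eq_cis cis_cnj cis_mult)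
  have e1: "F * F * e = F * cnj F"
    unfolding F_def e_def by (rule twist_square[OF assms(1)])
  \<comment> \<open>the two forms of \<open>twist_square\<close> that turn the cross terms holomorphic and antiholomorphic\<close>
  have e2: "F * cnj F * cnj e = F * F"
    using ee unfolding e1[symmetric] by (simp add: mult.assoc)
  have e3: "F * cnj F * e = cnj F * cnj F"
    using arg_cong[OF e2, of cnj] by (simp add: mult_ac)
  have S: "UNIV - {last_index} = insert first_index (UNIV - {first_index, last_index :: 'n})"
    using assms(2) by auto
  have sum: "(\<Sum>j\<in>UNIV - {last_index}. (z $ j * F) * cnj (z $ j * F)) = F * cnj F * (z1 * cnj z1 + Q)"
    unfolding S by (simp add: Q_def z1_def sum_distrib_left algebra_simps)
  have r: "complex_of_real (worm_r \<alpha> \<beta> M z) = (z1 - e) * cnj (z1 - e) + Q + W - 1"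
    unfolding worm_r_eq W_def Q_def z1_def e_def
    by (simp only: of_real_add of_real_diff of_real_sum complex_norm_square of_real_1)
  have "complex_of_real ((cmod F)\<^sup>2 * worm_r \<alpha> \<beta> M z) = F * cnj F * ((z1 - e) * cnj (z1 - e) + Q + W - 1)"
    by (simp only: of_real_mult complex_norm_square r)
  also have "\<dots> = F * cnj F * (z1 * cnj z1 + Q) - z1 * (F * cnj F * cnj e) - cnj z1 * (F * cnj F * e)
      + F * cnj F * (e * cnj e - 1) + F * cnj F * W"
    by (simp add: algebra_simps)
  also have "\<dots> = F * cnj F * (z1 * cnj z1 + Q) + ((- 1) * (z1 * (F * F)) + cnj ((- 1) * (z1 * (F * F)))) + F * cnj F * W"
    unfolding e2 e3 ee by simp
  finally show ?thesis unfolding sum W_def z1_def .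
qed

lemma levi_nonneg_twisted_worm_r:
  fixes p :: "complex ^ 'n::{finite,linorder}"
  assumes "(first_index :: 'n) \<noteq> last_index"
    and "p $ last_index \<noteq> 0" "M \<ge> exp 3" "wall \<beta> M ((cmod (p $ last_index))\<^sup>2) \<le> 1"
  shows "levi_nonneg_at (\<lambda>z. complex_of_real
    ((cmod (twist \<alpha> (p $ last_index) (z $ last_index)))\<^sup>2 * worm_r \<alpha> \<beta> M z)) p"
proof -
  define q where "q = p $ last_index"
  define V where "V = {w. Re (w * cnj q) > 0}"
  define U where "U = {z :: complex ^ 'n::{finite,linorder}. Re (z $ last_index * cnj q) > 0}"
  have V: "open V" unfolding V_def by (intro open_Collect_less continuous_intros)
  have U: "open U" unfolding U_def by (intro open_Collect_less continuous_intros)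
  have qV: "p $ last_index \<in> V" using assms(2) by (simp add: V_def q_def complex_neq_0 flip: power2_eq_square)
  then have pU: "p \<in> U" by (simp add: U_def V_def)
  obtain D where D: "((\<lambda>w. (- \<i> * complex_of_real \<alpha> / w) * twist \<alpha> q w) has_field_derivative D) (at (p $ last_index))"
    using twist_derivative_has_derivative qV unfolding V_def by blast
  have F: "holo_at (\<lambda>z. twist \<alpha> q (z $ last_index)) p"
    by (rule holo_at_coordinate[OF V qV twist_has_derivative D]) (simp add: V_def)
  have M: "0 \<le> M" using assms(3) exp_gt_zero[of "3::real"] by linarith
  have "levi_nonneg_at (\<lambda>z.
    (\<Sum>j\<in>UNIV - {last_index}. (z $ j * twist \<alpha> q (z $ last_index)) * cnj (z $ j * twist \<alpha> q (z $ last_index)))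
    + ((- 1) * (z $ first_index * (twist \<alpha> q (z $ last_index) * twist \<alpha> q (z $ last_index)))
      + cnj ((- 1) * (z $ first_index * (twist \<alpha> q (z $ last_index) * twist \<alpha> q (z $ last_index)))))
    + twist \<alpha> q (z $ last_index) * cnj (twist \<alpha> q (z $ last_index))
        * complex_of_real (wall \<beta> M ((cmod (z $ last_index))\<^sup>2))) p"
  proof (rule levi_nonneg_at_add[OF levi_nonneg_at_add])
    show "levi_nonneg_at (\<lambda>z. \<Sum>j\<in>UNIV - {last_index}.
        (z $ j * twist \<alpha> q (z $ last_index)) * cnj (z $ j * twist \<alpha> q (z $ last_index))) p"
      by (rule levi_nonneg_at_sum, rule levi_nonneg_at_norm_square, rule holo_at_mult[OF holo_at_component F])
    show "levi_nonneg_at (\<lambda>z. (- 1) * (z $ first_index * (twist \<alpha> q (z $ last_index) * twist \<alpha> q (z $ last_index)))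
      + cnj ((- 1) * (z $ first_index * (twist \<alpha> q (z $ last_index) * twist \<alpha> q (z $ last_index))))) p"
      by (rule levi_nonneg_at_pluriharmonic[OF holo_at_mult[OF holo_at_const
              holo_at_mult[OF holo_at_component holo_at_mult[OF F F]]]])
    show "levi_nonneg_at (\<lambda>z. twist \<alpha> q (z $ last_index) * cnj (twist \<alpha> q (z $ last_index))
        * complex_of_real (wall \<beta> M ((cmod (z $ last_index))\<^sup>2))) p"
      unfolding q_def
      by (rule levi_nonneg_twisted_wall[OF assms(2) wall_nonneg[OF M] wall_subharmonic[OF M _ wall_small[OF assms(3,4)]]])
        (simp add: assms(2))
  qed
  then show ?thesis
    by (rule levi_nonneg_at_cong[OF _ U pU])
      (simp only: U_def mem_Collect_eq twisted_worm_r_eq[OF _ assms(1)] q_def)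
qed

section \<open>The boundary\<close>

text \<open>The centre of the ball that is the fibre of the worm over \<open>w\<close>.\<close>

definition axis_point :: "real \<Rightarrow> complex \<Rightarrow> complex ^ 'n::{finite,linorder}" where
  "axis_point \<alpha> w = (\<chi> j. if j = last_index then w else if j = first_index then phase \<alpha> w else 0)"

definition axis_dist2 :: "real \<Rightarrow> complex ^ 'n::{finite,linorder} \<Rightarrow> real" where
  "axis_dist2 \<alpha> z = (cmod (z $ first_index - phase \<alpha> (z $ last_index)))\<^sup>2
     + (\<Sum>j \<in> UNIV - {first_index, last_index}. (cmod (z $ j))\<^sup>2)"

lemma worm_r_axis_dist2:
  "worm_r \<alpha> \<beta> M z = axis_dist2 \<alpha> z + wall \<beta> M ((cmod (z $ last_index))\<^sup>2) - 1"
  by (simp add: worm_r_eq axis_dist2_def)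

lemma axis_dist2_nonneg: "0 \<le> axis_dist2 \<alpha> z"
  by (simp add: axis_dist2_def sum_nonneg)

text \<open>Along the segment from \<open>z\<close> to the centre of its fibre the last coordinate is constant and the
distance to the centre scales by \<open>1 - t\<close>. This gives a direction in which \<open>r\<close> has a
nonzero derivative, and also shows that the fibres of the domain are star-shaped.\<close>

lemma worm_r_toward_axis:
  fixes z :: "complex ^ 'n::{finite,linorder}"
  assumes "(first_index :: 'n) \<noteq> last_index"
  shows "worm_r \<alpha> \<beta> M (z + t *\<^sub>R (axis_point \<alpha> (z $ last_index) - z)) =
    (1 - t)\<^sup>2 * axis_dist2 \<alpha> z + wall \<beta> M ((cmod (z $ last_index))\<^sup>2) - 1"
proof -
  define x where "x = z + t *\<^sub>R (axis_point \<alpha> (z $ last_index) - z)"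
  have l: "x $ last_index = z $ last_index"
    by (simp add: x_def axis_point_def)
  have f: "x $ first_index - phase \<alpha> (x $ last_index) = (1 - t) *\<^sub>R (z $ first_index - phase \<alpha> (z $ last_index))"
    unfolding l using assms by (simp add: x_def axis_point_def algebra_simps)
  have "x $ j = (1 - t) *\<^sub>R z $ j" if "j \<in> UNIV - {first_index, last_index}" for j
    using that by (simp add: x_def axis_point_def algebra_simps)
  then have "(\<Sum>j \<in> UNIV - {first_index, last_index}. (cmod (x $ j))\<^sup>2) =
      (1 - t)\<^sup>2 * (\<Sum>j \<in> UNIV - {first_index, last_index}. (cmod (z $ j))\<^sup>2)"
    unfolding sum_distrib_left by (intro sum.cong refl) (simp add: power_mult_distrib)
  then have "axis_dist2 \<alpha> x = (1 - t)\<^sup>2 * axis_dist2 \<alpha> z"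
    unfolding axis_dist2_def f by (simp only: norm_scaleR power_mult_distrib power2_abs distrib_left)
  then show ?thesis
    unfolding x_def[symmetric] worm_r_axis_dist2 l by simp
qed

lemma worm_r_nonpos_bounds:
  fixes z :: "complex ^ 'n::{finite,linorder}"
  assumes "M \<ge> exp 3" "worm_r \<alpha> \<beta> M z \<le> 0"
  shows "wall \<beta> M ((cmod (z $ last_index))\<^sup>2) \<le> 1"
    and "2 / 3 \<le> (cmod (z $ last_index))\<^sup>2" "(cmod (z $ last_index))\<^sup>2 \<le> \<beta>\<^sup>2 + 1 / 3"
    and "z $ last_index \<noteq> 0" "axis_dist2 \<alpha> z \<le> 1"
proof -
  have "0 \<le> M" using assms(1) exp_gt_zero[of "3::real"] by linarith
  then show w: "wall \<beta> M ((cmod (z $ last_index))\<^sup>2) \<le> 1" and "axis_dist2 \<alpha> z \<le> 1"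
    using assms(2) axis_dist2_nonneg[of \<alpha> z] wall_nonneg[of M \<beta> "(cmod (z $ last_index))\<^sup>2"]
    unfolding worm_r_axis_dist2 by linarith+
  show "2 / 3 \<le> (cmod (z $ last_index))\<^sup>2" "(cmod (z $ last_index))\<^sup>2 \<le> \<beta>\<^sup>2 + 1 / 3"
    using wall_small[OF assms(1) w] by linarith+
  then show "z $ last_index \<noteq> 0" by auto
qed

lemma worm_domain_eq:
  assumes "M \<ge> exp 3"
  shows "worm_domain \<alpha> \<beta> M = {z. worm_r \<alpha> \<beta> M z < 0}"
proof -
  have "z $ last_index \<noteq> 0" if "worm_r \<alpha> \<beta> M z < 0" for z :: "complex ^ 'a::{finite,linorder}"
    using worm_r_nonpos_bounds(4)[OF assms, of \<alpha> \<beta> z] that by simp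
  then show ?thesis by (auto simp: worm_domain_def)
qed

lemma worm_r_differentiable:
  fixes z :: "complex ^ 'n::{finite,linorder}"
  assumes "z $ last_index \<noteq> 0"
  shows "(worm_r \<alpha> \<beta> M has_derivative frechet_derivative (worm_r \<alpha> \<beta> M) (at z)) (at z)"
  using assms by (intro Ck_on_Suc_has_derivative[OF smooth_worm_r]) simp

lemma continuous_on_worm_r:
  "continuous_on {z :: complex ^ 'n::{finite,linorder}. z $ last_index \<noteq> 0} (worm_r \<alpha> \<beta> M)"
  using smooth_worm_r[of 0] by simp

lemma has_derivative_along_line:
  assumes "(f has_derivative D) (at p)"
  shows "((\<lambda>t. f (p + t *\<^sub>R v)) has_real_derivative D v) (at 0)"
proof -
  have "((\<lambda>t. p + t *\<^sub>R v) has_derivative (\<lambda>t. t *\<^sub>R v)) (at (0::real))"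
    by (auto intro!: derivative_eq_intros)
  moreover have "(f has_derivative D) (at (p + 0 *\<^sub>R v))"
    using assms by simp
  ultimately have "((\<lambda>t. f (p + t *\<^sub>R v)) has_derivative (\<lambda>t. D (t *\<^sub>R v))) (at 0)"
    by (rule has_derivative_compose)
  moreover have "D (t *\<^sub>R v) = D v * t" for t
    using linear_cmul[OF has_derivative_linear[OF assms], of t v] by simp
  ultimately show ?thesis
    by (simp add: has_field_derivative_def)
qed

text \<open>Off the curve of centres, differentiate towards the centre: the derivative is minus twice the squared
distance. At a centre, differentiate in the direction of \<open>q\<close>, which rescales \<open>\<bar>w\<bar>\<close>: the
squared distance of \<open>z\<^sub>1\<close> to the moving phase has derivative \<open>0\<close>, since it attains its
minimum \<open>0\<close>, and the cut-off term has a nonzero derivative because its value is \<open>1\<close>.\<close>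

lemma worm_r_derivative_nonzero:
  fixes p :: "complex ^ 'n::{finite,linorder}"
  assumes "(first_index :: 'n) \<noteq> last_index" "M \<ge> exp 3" "\<beta> > 1" "worm_r \<alpha> \<beta> M p = 0"
  shows "\<exists>v. frechet_derivative (worm_r \<alpha> \<beta> M) (at p) v \<noteq> 0"
proof -
  define q where "q = p $ last_index"
  have q0: "q \<noteq> 0" using worm_r_nonpos_bounds(4)[OF assms(2), of \<alpha> \<beta> p] assms(4) by (simp add: q_def)
  have M: "M > 0" using assms(2) exp_gt_zero[of "3::real"] by linarith
  note line = has_derivative_along_line[OF worm_r_differentiable[OF q0[unfolded q_def]]]
  show ?thesis
  proof (cases "axis_dist2 \<alpha> p = 0")
    case False
    have "((\<lambda>t. (1 - t)\<^sup>2 * axis_dist2 \<alpha> p + wall \<beta> M ((cmod (p $ last_index))\<^sup>2) - 1)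
        has_real_derivative - 2 * axis_dist2 \<alpha> p) (at 0)"
      by (auto intro!: derivative_eq_intros)
    then have "((\<lambda>t. worm_r \<alpha> \<beta> M (p + t *\<^sub>R (axis_point \<alpha> (p $ last_index) - p)))
        has_real_derivative - 2 * axis_dist2 \<alpha> p) (at 0)"
      unfolding worm_r_toward_axis[OF assms(1)] .
    from DERIV_unique[OF line this] False show ?thesis
      by (intro exI[of _ "axis_point \<alpha> (p $ last_index) - p"]) simp
  next
    case True
    define s where "s = cmod q"
    have s: "s > 0" using q0 by (simp add: s_def)
    define \<theta> where "\<theta> = 2 * \<alpha> * ln s"
    have wall1: "wall \<beta> M (s\<^sup>2) = 1"
      using assms(4) True by (simp add: worm_r_axis_dist2 s_def q_def)
    have sum0: "(\<Sum>j \<in> UNIV - {first_index, last_index}. (cmod (p $ j))\<^sup>2) = 0"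
      and p1: "p $ first_index = cis \<theta>"
    proof -
      have "0 \<le> (\<Sum>j \<in> UNIV - {first_index, last_index}. (cmod (p $ j))\<^sup>2)" by (simp add: sum_nonneg)
      with True have "(cmod (p $ first_index - phase \<alpha> (p $ last_index)))\<^sup>2 = 0"
        and "(\<Sum>j \<in> UNIV - {first_index, last_index}. (cmod (p $ j))\<^sup>2) = 0"
        unfolding axis_dist2_def by (smt (verit) zero_le_power2)+
      then show "(\<Sum>j \<in> UNIV - {first_index, last_index}. (cmod (p $ j))\<^sup>2) = 0" "p $ first_index = cis \<theta>"
        by (simp_all add: phase_eq_cis \<theta>_def s_def q_def)
    qed
    \<comment> \<open>\<open>g\<close> is \<open>r\<close> along the ray through \<open>q\<close>; the formula is valid for \<open>t > -1\<close>, where the last coordinate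
      does not vanish.\<close>
    define g where "g t = (cos \<theta> - cos (2 * \<alpha> * ln ((1 + t) * s)))\<^sup>2 + (sin \<theta> - sin (2 * \<alpha> * ln ((1 + t) * s)))\<^sup>2
      + wall \<beta> M (((1 + t) * s)\<^sup>2) - 1" for t
    have line_eq: "g t = worm_r \<alpha> \<beta> M (p + t *\<^sub>R axis last_index q)" if "t \<in> {-1<..}" for t
    proof -
      define x where "x = p + t *\<^sub>R axis last_index q"
      have other: "x $ j = p $ j" if "j \<noteq> last_index" for j
        using that by (simp add: x_def axis_def)
      have "x $ last_index = (1 + t) *\<^sub>R q"
        by (simp add: x_def q_def algebra_simps)
      then have n: "cmod (x $ last_index) = (1 + t) * s"
        using that by (simp add: s_def)
      have "(cmod (x $ first_index - phase \<alpha> (x $ last_index)))\<^sup>2 =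
          (cos \<theta> - cos (2 * \<alpha> * ln ((1 + t) * s)))\<^sup>2 + (sin \<theta> - sin (2 * \<alpha> * ln ((1 + t) * s)))\<^sup>2"
        unfolding phase_eq_cis n other[OF assms(1)] p1 cmod_power2 by simp
      moreover have "(\<Sum>j \<in> UNIV - {first_index, last_index}. (cmod (x $ j))\<^sup>2) = 0"
        unfolding sum0[symmetric] by (rule sum.cong) (auto simp: other)
      ultimately show ?thesis unfolding x_def[symmetric] worm_r_eq n g_def by simp
    qed
    have "((\<lambda>t. wall \<beta> M (((1 + t) * s)\<^sup>2)) has_real_derivative wall' \<beta> M (((1 + 0) * s)\<^sup>2) * (2 * s\<^sup>2)) (at 0)"
      by (rule DERIV_chain2[OF wall_has_derivative]) (auto intro!: derivative_eq_intros simp: power2_eq_square)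
    then have "(g has_real_derivative wall' \<beta> M (s\<^sup>2) * (2 * s\<^sup>2)) (at 0)"
      unfolding g_def[abs_def] using s by (auto intro!: derivative_eq_intros simp: \<theta>_def)
    then have "((\<lambda>t. worm_r \<alpha> \<beta> M (p + t *\<^sub>R axis last_index q)) has_real_derivative
        wall' \<beta> M (s\<^sup>2) * (2 * s\<^sup>2)) (at 0)"
      by (rule has_field_derivative_transform_within_open[where S = "{-1<..}"]) (simp_all add: line_eq)
    from DERIV_unique[OF line this] wall'_neq_0[OF M assms(3), of "s\<^sup>2"] wall1 s
    show ?thesis by (intro exI[of _ "axis last_index q"]) simp
  qed
qed

text \<open>A zero with nonvanishing derivative is no local minimum; so the zeros of \<open>r\<close> are limits of
points of the domain.\<close>

lemma negative_values_nearby: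
  fixes f :: "'a::real_normed_vector \<Rightarrow> real"
  assumes "(f has_derivative D) (at p)" "D v \<noteq> 0" "f p = 0"
  shows "p \<in> closure {x. f x < 0}"
proof -
  obtain u where u: "D u < 0"
  proof (cases "D v < 0")
    case False
    then have "D (- v) < 0" using assms(2) linear_neg[OF has_derivative_linear[OF assms(1)], of v] by simp
    with that show ?thesis by blast
  qed
  obtain d where d: "d > 0" "\<And>h. 0 < h \<Longrightarrow> h < d \<Longrightarrow> f (p + h *\<^sub>R u) < 0"
    using DERIV_neg_dec_right[OF has_derivative_along_line[OF assms(1)] u] assms(3) by auto
  have u0: "u \<noteq> 0" using u linear_0[OF has_derivative_linear[OF assms(1)]] by auto
  show ?thesis unfolding closure_approachable
  proof (intro allI impI)
    fix e :: real assume e: "e > 0"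
    define h where "h = min (d / 2) (e / (2 * norm u))"
    have h: "0 < h" "h < d" "h \<le> e / (2 * norm u)" using d(1) e u0 by (auto simp: h_def)
    have "h * norm u \<le> e / 2" using h(3) u0 by (simp add: field_simps)
    then have "dist (p + h *\<^sub>R u) p < e" using h(1) e by (simp add: dist_norm)
    then show "\<exists>y\<in>{x. f x < 0}. dist y p < e" using d(2)[OF h(1,2)] by blast
  qed
qed

lemma open_worm_domain:
  fixes \<alpha> \<beta> M :: real
  shows "open (worm_domain \<alpha> \<beta> M :: (complex ^ 'n::{finite,linorder}) set)"
proof -
  have "worm_domain \<alpha> \<beta> M = {z :: complex ^ 'n::{finite,linorder}. z $ last_index \<noteq> 0} \<inter> worm_r \<alpha> \<beta> M -` {..<0}"
    by (auto simp: worm_domain_def)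
  then show ?thesis
    using continuous_open_preimage[OF continuous_on_worm_r open_last_nonzero open_lessThan] by metis
qed

lemma frontier_worm_domain:
  assumes "(first_index :: 'n::{finite,linorder}) \<noteq> last_index" "M \<ge> exp 3" "\<beta> > 1"
  shows "frontier (worm_domain \<alpha> \<beta> M) = {z :: complex ^ 'n::{finite,linorder}. worm_r \<alpha> \<beta> M z = 0}"
proof (intro equalityI subsetI)
  fix z :: "complex ^ 'n::{finite,linorder}"
  assume "z \<in> frontier (worm_domain \<alpha> \<beta> M)"
  then have cl: "z \<in> closure (worm_domain \<alpha> \<beta> M)" and nin: "z \<notin> worm_domain \<alpha> \<beta> M"
    by (simp_all add: frontier_def interior_open[OF open_worm_domain])
  \<comment> \<open>The closed condition \<open>\<bar>w\<bar>\<^sup>2 \<ge> 2 / 3\<close> keeps limit points off \<open>w = 0\<close>, where \<open>r\<close> is not continuous.\<close>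
  have "closed {z :: complex ^ 'n::{finite,linorder}. 2 / 3 \<le> (cmod (z $ last_index))\<^sup>2}"
    by (intro closed_Collect_le continuous_intros)
  moreover have "worm_domain \<alpha> \<beta> M \<subseteq> {z :: complex ^ 'n::{finite,linorder}. 2 / 3 \<le> (cmod (z $ last_index))\<^sup>2}"
    using worm_r_nonpos_bounds(2)[OF assms(2), of \<alpha> \<beta>] by (auto simp: worm_domain_def intro: less_imp_le)
  ultimately have "2 / 3 \<le> (cmod (z $ last_index))\<^sup>2"
    using cl closure_minimal by blast
  then have z0: "z $ last_index \<noteq> 0" by auto
  have "worm_r \<alpha> \<beta> M z \<le> 0"
  proof (rule ccontr)
    let ?P = "{z :: complex ^ 'n::{finite,linorder}. z $ last_index \<noteq> 0} \<inter> worm_r \<alpha> \<beta> M -` {0<..}"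
    assume "\<not> worm_r \<alpha> \<beta> M z \<le> 0"
    then have "z \<in> ?P" using z0 by simp
    moreover have "open ?P"
      by (rule continuous_open_preimage[OF continuous_on_worm_r open_last_nonzero open_greaterThan])
    ultimately obtain x where "x \<in> ?P" "x \<in> worm_domain \<alpha> \<beta> M"
      using cl by (meson closure_iff_nhds_not_empty disjoint_iff open_Int_closure_eq_empty)
    then show False by (simp add: worm_domain_def)
  qed
  then show "z \<in> {z. worm_r \<alpha> \<beta> M z = 0}"
    using nin z0 by (simp add: worm_domain_def)
next
  fix z :: "complex ^ 'n::{finite,linorder}"
  assume "z \<in> {z. worm_r \<alpha> \<beta> M z = 0}"
  then have r0: "worm_r \<alpha> \<beta> M z = 0" by simp
  then have z0: "z $ last_index \<noteq> 0" using worm_r_nonpos_bounds(4)[OF assms(2), of \<alpha> \<beta> z] by simp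
  obtain v where "frechet_derivative (worm_r \<alpha> \<beta> M) (at z) v \<noteq> 0"
    using worm_r_derivative_nonzero[OF assms r0] by blast
  from negative_values_nearby[OF worm_r_differentiable[OF z0] this r0]
  have "z \<in> closure (worm_domain \<alpha> \<beta> M)" by (simp add: worm_domain_eq[OF assms(2)])
  moreover have "z \<notin> worm_domain \<alpha> \<beta> M" using r0 by (simp add: worm_domain_def)
  ultimately show "z \<in> frontier (worm_domain \<alpha> \<beta> M)"
    by (simp_all add: frontier_def interior_open[OF open_worm_domain])
qed

lemma smooth_cmod_twist:
  "Ck_on k {z :: complex ^ 'n. Re (z $ l * cnj q) > 0} (\<lambda>z. (cmod (twist \<alpha> q (z $ l)))\<^sup>2)"
proof -
  let ?V = "{z :: complex ^ 'n. Re (z $ l * cnj q) > 0}"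
  have V: "open ?V" by (intro open_Collect_less continuous_intros)
  have Re: "Ck_on k ?V (\<lambda>z. Re (z $ l * cnj q))" and Im: "Ck_on k ?V (\<lambda>z. Im (z $ l * cnj q))"
    by (intro Ck_on_linear V bounded_linear_compose[OF bounded_linear_Re] bounded_linear_compose[OF bounded_linear_Im]
        bounded_linear_compose[OF bounded_linear_mult_left] bounded_linear_vec_nth)+
  have "Ck_on k ?V (\<lambda>z. exp (2 * \<alpha> * arctan (Im (z $ l * cnj q) * inverse (Re (z $ l * cnj q)))))"
    by (intro Ck_on_exp[OF V] Ck_on_mult[OF V Ck_on_const[OF V]] Ck_on_arctan[OF V] Ck_on_mult[OF V Im]
        Ck_on_inverse[OF V Re]) simp
  then show ?thesis
    by (rule Ck_on_cong[OF V, THEN iffD2, rotated]) (simp add: cmod_twist_arctan divide_inverse)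
qed

text \<open>A local defining function must be regular on its whole neighbourhood, whereas regularity is only
established at boundary points; this lemma provides the smaller neighbourhood.\<close>

lemma open_derivative_nonzero:
  assumes "open V" "smooth_on V \<rho>"
  shows "open {x \<in> V. frechet_derivative \<rho> (at x) \<noteq> (\<lambda>v. 0)}"
proof -
  have "continuous_on V (\<lambda>x. frechet_derivative \<rho> (at x) v)" for v
    using assms(2) Ck_on_Suc_frechet[of 0 V \<rho> v] by (simp add: smooth_on_def)
  then have "open (V \<inter> (\<lambda>x. frechet_derivative \<rho> (at x) v) -` (- {0}))" for v
    using assms(1) by (intro continuous_open_preimage) auto
  then have "open (\<Union>v. V \<inter> (\<lambda>x. frechet_derivative \<rho> (at x) v) -` (- {0}))" by blast
  moreover have "(\<Union>v. V \<inter> (\<lambda>x. frechet_derivative \<rho> (at x) v) -` (- {0})) =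
      {x \<in> V. frechet_derivative \<rho> (at x) \<noteq> (\<lambda>v. 0)}"
    by (auto simp: fun_eq_iff)
  ultimately show ?thesis by simp
qed

text \<open>Multiplication by the positive smooth function \<open>\<bar>F\<bar>\<^sup>2\<close> changes neither the sign nor the zeros of
\<open>r\<close>, and at a zero of \<open>r\<close> it multiplies the derivative by \<open>\<bar>F\<bar>\<^sup>2\<close>.\<close>

lemma twisted_local_defining_function:
  fixes p :: "complex ^ 'n::{finite,linorder}"
  assumes "(first_index :: 'n) \<noteq> last_index" "M \<ge> exp 3" "\<beta> > 1" "p \<in> frontier (worm_domain \<alpha> \<beta> M)"
  defines "\<rho> \<equiv> \<lambda>z. (cmod (twist \<alpha> (p $ last_index) (z $ last_index)))\<^sup>2 * worm_r \<alpha> \<beta> M z"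
  shows "\<exists>U. p \<in> U \<and> local_defining_function (worm_domain \<alpha> \<beta> M) U \<rho>"
proof -
  note fr = frontier_worm_domain[OF assms(1-3), of \<alpha>]
  have r0: "worm_r \<alpha> \<beta> M p = 0" using assms(4) fr by simp
  define q where "q = p $ last_index"
  define V where "V = {z :: complex ^ 'n::{finite,linorder}. Re (z $ last_index * cnj q) > 0}"
  define G where "G z = (cmod (twist \<alpha> q (z $ last_index)))\<^sup>2" for z :: "complex ^ 'n::{finite,linorder}"
  have V: "open V" unfolding V_def by (intro open_Collect_less continuous_intros)
  have q0: "q \<noteq> 0" using worm_r_nonpos_bounds(4)[OF assms(2), of \<alpha> \<beta> p] r0 by (simp add: q_def)
  have pV: "p \<in> V" using q0 by (simp add: V_def q_def complex_neq_0 flip: power2_eq_square)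
  have V0: "V \<subseteq> {z. z $ last_index \<noteq> 0}" using halfplane_nonzero(1) by (auto simp: V_def)
  have Gpos: "G z > 0" for z by (simp add: G_def twist_def)
  have \<rho>: "\<rho> = (\<lambda>z. G z * worm_r \<alpha> \<beta> M z)" by (simp add: \<rho>_def G_def q_def)
  have sG: "Ck_on k V G" for k unfolding G_def[abs_def] V_def by (rule smooth_cmod_twist)
  have s\<rho>: "smooth_on V \<rho>" unfolding \<rho> smooth_on_def
    by (intro allI Ck_on_mult[OF V sG] Ck_on_subset[OF smooth_worm_r V0])
  \<comment> \<open>Regularity of \<open>\<rho>\<close> is established at \<open>p\<close> only, so the half plane is cut down to its regular part.\<close>
  define U where "U = {x \<in> V. frechet_derivative \<rho> (at x) \<noteq> (\<lambda>v. 0)}"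
  obtain v where v: "frechet_derivative (worm_r \<alpha> \<beta> M) (at p) v \<noteq> 0"
    using worm_r_derivative_nonzero[OF assms(1-3) r0] by blast
  have "(\<rho> has_derivative (\<lambda>v. G p * frechet_derivative (worm_r \<alpha> \<beta> M) (at p) v
      + frechet_derivative G (at p) v * worm_r \<alpha> \<beta> M p)) (at p)"
    unfolding \<rho> by (rule has_derivative_mult[OF Ck_on_Suc_has_derivative[OF sG pV]
          worm_r_differentiable[OF q0[unfolded q_def]]])
  from frechet_derivative_at[OF this]
  have "frechet_derivative \<rho> (at p) v \<noteq> 0"
    using v Gpos[of p] r0 by (metis (no_types, lifting) add.right_neutral less_irrefl mult_eq_0_iff)
  then have pU: "p \<in> U" using pV by (auto simp: U_def)
  have "smooth_on U \<rho>"
    using s\<rho> Ck_on_subset[of _ V \<rho> U] by (auto simp: smooth_on_def U_def)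
  moreover have "open U" unfolding U_def by (rule open_derivative_nonzero[OF V s\<rho>])
  moreover have sgn: "\<rho> x < 0 \<longleftrightarrow> worm_r \<alpha> \<beta> M x < 0" "\<rho> x = 0 \<longleftrightarrow> worm_r \<alpha> \<beta> M x = 0" for x
    using Gpos[of x] by (auto simp: \<rho> mult_less_0_iff)
  moreover have "U \<inter> worm_domain \<alpha> \<beta> M = {x \<in> U. \<rho> x < 0}"
    unfolding sgn worm_domain_eq[OF assms(2)] by blast
  moreover have "U \<inter> frontier (worm_domain \<alpha> \<beta> M) = {x \<in> U. \<rho> x = 0}"
    unfolding sgn fr by blast
  ultimately have "local_defining_function (worm_domain \<alpha> \<beta> M) U \<rho>"
    unfolding local_defining_function_def by (auto simp: U_def)
  with pU show ?thesis by blast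
qed

section \<open>Connectedness and boundedness\<close>

text \<open>The exact threshold, which makes the set of admissible \<open>w\<close> a round annulus.\<close>

lemma flat_below_one_iff:
  assumes "M \<ge> exp 3"
  shows "M * flat 0 t < 1 \<longleftrightarrow> t < 1 / ln M"
proof -
  have M: "M > 0" using assms exp_gt_zero[of "3::real"] by linarith
  have L: "ln M > 0" using assms M by (smt (verit) ln_ge_iff)
  show ?thesis
  proof (cases "t > 0")
    case True
    have "M * flat 0 t = exp (ln M - 1 / t)"
      using True M by (simp add: flat_def exp_diff divide_inverse flip: exp_minus)
    then show ?thesis using True L by (simp add: field_simps)
  next
    case False
    then have "t < 1 / ln M" using L by (meson divide_pos_pos less_le_trans not_less zero_less_one le_less_trans)
    then show ?thesis using False by simp
  qed
qed

lemma connected_wall_below_one: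
  assumes "M \<ge> exp 3" "\<beta> > 1"
  shows "connected {w. wall \<beta> M ((cmod w)\<^sup>2) < 1}"
proof -
  have b: "\<beta>\<^sup>2 > 1" using assms(2) by simp
  have M: "M > 0" using assms(1) exp_gt_zero[of "3::real"] by linarith
  define c where "c = 1 / ln M"
  have "ln M \<ge> 3" using assms(1) M by (simp add: ln_ge_iff)
  then have c: "c \<le> 1"
    unfolding c_def by (simp add: divide_le_eq_1)
  have "wall \<beta> M ((cmod w)\<^sup>2) < 1 \<longleftrightarrow> sqrt (1 - c) < cmod w \<and> cmod w < sqrt (\<beta>\<^sup>2 + c)" for w
  proof -
    have "wall \<beta> M ((cmod w)\<^sup>2) < 1 \<longleftrightarrow>
        M * flat 0 ((cmod w)\<^sup>2 - \<beta>\<^sup>2) < 1 \<and> M * flat 0 (1 - (cmod w)\<^sup>2) < 1"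
      using b by (cases "(cmod w)\<^sup>2 < 1") (auto simp: wall_def)
    also have "\<dots> \<longleftrightarrow> 1 - c < (cmod w)\<^sup>2 \<and> (cmod w)\<^sup>2 < \<beta>\<^sup>2 + c"
      unfolding flat_below_one_iff[OF assms(1)] c_def by auto
    also have "1 - c < (cmod w)\<^sup>2 \<longleftrightarrow> sqrt (1 - c) < cmod w"
      using real_sqrt_less_iff[of "1 - c" "(cmod w)\<^sup>2"] by simp
    also have "(cmod w)\<^sup>2 < \<beta>\<^sup>2 + c \<longleftrightarrow> cmod w < sqrt (\<beta>\<^sup>2 + c)"
      using real_sqrt_less_iff[of "(cmod w)\<^sup>2" "\<beta>\<^sup>2 + c"] by simp
    finally show ?thesis .
  qed
  then show ?thesis
    using connected_annulus(1)[where 'N = complex, of "sqrt (1 - c)" 0 "sqrt (\<beta>\<^sup>2 + c)"] by simp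
qed

text \<open>Each point is joined to the centre of its fibre by a segment in the domain, and the centres are the
continuous image of an annulus.\<close>

lemma connected_worm_domain:
  assumes "(first_index :: 'n::{finite,linorder}) \<noteq> last_index" "M \<ge> exp 3" "\<beta> > 1"
  shows "connected (worm_domain \<alpha> \<beta> M :: (complex ^ 'n::{finite,linorder}) set)"
proof -
  let ?\<Omega> = "worm_domain \<alpha> \<beta> M :: (complex ^ 'n::{finite,linorder}) set"
  let ?c = "axis_point \<alpha> :: complex \<Rightarrow> complex ^ 'n::{finite,linorder}"
  define A where "A = {w. wall \<beta> M ((cmod w)\<^sup>2) < 1}"
  have axis: "worm_r \<alpha> \<beta> M (?c w) = wall \<beta> M ((cmod w)\<^sup>2) - 1" for w
    using assms(1) by (simp add: worm_r_eq axis_point_def)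
  then have cA: "?c ` A \<subseteq> ?\<Omega>"
    by (auto simp: A_def worm_domain_eq[OF assms(2)])
  have A0: "w \<noteq> 0" if "w \<in> A" for w
    using wall_small(2)[OF assms(2), of \<beta> "(cmod w)\<^sup>2"] that by (auto simp: A_def)
  have "continuous_on A (phase \<alpha>)"
    unfolding phase_def[abs_def] by (intro continuous_intros) (simp add: A0)
  then have "continuous_on A (\<lambda>w. if j = last_index then w else if j = first_index then phase \<alpha> w else 0)" for j :: 'n
    by (cases "j = last_index"; cases "j = first_index") simp_all
  then have "continuous_on A ?c"
    unfolding axis_point_def by (rule continuous_on_vec_lambda)
  then have conn: "connected (?c ` A)"
    using connected_continuous_image connected_wall_below_one[OF assms(2,3)] unfolding A_def by blast
  have to_axis: "connected_component ?\<Omega> z (?c (z $ last_index))" and inA: "z $ last_index \<in> A"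
    if z: "z \<in> ?\<Omega>" for z
  proof -
    have neg: "axis_dist2 \<alpha> z + wall \<beta> M ((cmod (z $ last_index))\<^sup>2) - 1 < 0"
      using z by (simp add: worm_domain_eq[OF assms(2)] worm_r_axis_dist2)
    then show "z $ last_index \<in> A"
      using axis_dist2_nonneg[of \<alpha> z] by (simp add: A_def)
    have "closed_segment z (?c (z $ last_index)) \<subseteq> ?\<Omega>"
    proof
      fix x assume "x \<in> closed_segment z (?c (z $ last_index))"
      then obtain t where t: "0 \<le> t" "t \<le> 1" and x: "x = z + t *\<^sub>R (?c (z $ last_index) - z)"
        by (auto simp: closed_segment_def algebra_simps)
      have "(1 - t)\<^sup>2 * axis_dist2 \<alpha> z \<le> axis_dist2 \<alpha> z"
        using t by (intro mult_left_le_one_le axis_dist2_nonneg) (auto simp: power_le_one)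
      with neg show "x \<in> ?\<Omega>"
        unfolding worm_domain_eq[OF assms(2)] x mem_Collect_eq worm_r_toward_axis[OF assms(1)] by linarith
    qed
    then show "connected_component ?\<Omega> z (?c (z $ last_index))"
      unfolding connected_component_def
      by (intro exI[of _ "closed_segment z (?c (z $ last_index))"]) simp
  qed
  show ?thesis unfolding connected_iff_connected_component
  proof (intro ballI)
    fix x y assume xy: "x \<in> ?\<Omega>" "y \<in> ?\<Omega>"
    have "connected_component ?\<Omega> (?c (x $ last_index)) (?c (y $ last_index))"
      unfolding connected_component_def using conn cA inA[OF xy(1)] inA[OF xy(2)] by blast
    then show "connected_component ?\<Omega> x y"
      using to_axis[OF xy(1)] to_axis[OF xy(2)] by (meson connected_component_trans connected_component_sym)
  qed
qed

text \<open>All coordinates but the last are within distance \<open>1\<close> of those of a centre, and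
\<open>\<bar>w\<bar>\<^sup>2 \<le> \<beta>\<^sup>2 + 1 / 3 \<le> (\<beta> + 1)\<^sup>2\<close>.\<close>

lemma bounded_worm_domain:
  assumes "M \<ge> exp 3" "\<beta> > 1"
  shows "bounded (worm_domain \<alpha> \<beta> M :: (complex ^ 'n::{finite,linorder}) set)"
proof -
  have "norm z \<le> CARD('n) * (\<beta> + 1)" if "z \<in> worm_domain \<alpha> \<beta> M" for z :: "complex ^ 'n::{finite,linorder}"
  proof -
    have r: "worm_r \<alpha> \<beta> M z \<le> 0" using that by (simp add: worm_domain_def)
    note b = worm_r_nonpos_bounds[OF assms(1) r]
    have dist1: "cmod w \<le> 1" if "(cmod w)\<^sup>2 \<le> axis_dist2 \<alpha> z" for w
    proof (rule power2_le_imp_le)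
      show "(cmod w)\<^sup>2 \<le> 1\<^sup>2" using that b(5) by simp
    qed simp
    have "cmod (z $ j) \<le> \<beta> + 1" for j
    proof -
      consider "j = last_index" | "j = first_index" | "j \<in> UNIV - {first_index, last_index}" by blast
      then show ?thesis
      proof cases
        case 1
        have "(cmod (z $ last_index))\<^sup>2 \<le> (\<beta> + 1)\<^sup>2"
          using b(3) assms(2) by (simp add: power2_sum)
        then show ?thesis unfolding 1 by (rule power2_le_imp_le) (use assms(2) in simp)
      next
        case 2
        have "cmod (z $ first_index - phase \<alpha> (z $ last_index)) \<le> 1"
          by (rule dist1) (simp add: axis_dist2_def sum_nonneg)
        then have "cmod (z $ first_index) \<le> 1 + cmod (phase \<alpha> (z $ last_index))"
          using norm_triangle_sub[of "z $ first_index" "phase \<alpha> (z $ last_index)"] by linarith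
        then show ?thesis unfolding 2 using assms(2) by (simp add: phase_eq_cis)
      next
        case 3
        have "(cmod (z $ j))\<^sup>2 \<le> (\<Sum>j \<in> UNIV - {first_index, last_index}. (cmod (z $ j))\<^sup>2)"
          using 3 by (intro member_le_sum) auto
        then have "(cmod (z $ j))\<^sup>2 \<le> axis_dist2 \<alpha> z"
          unfolding axis_dist2_def by (simp add: add_increasing)
        from dist1[OF this] show ?thesis using assms(2) by linarith
      qed
    qed
    then have "(\<Sum>j\<in>UNIV. cmod (z $ j)) \<le> CARD('n) * (\<beta> + 1)"
      using sum_bounded_above[of UNIV "\<lambda>j. cmod (z $ j)" "\<beta> + 1"] by simp
    moreover have "norm z \<le> (\<Sum>j\<in>UNIV. cmod (z $ j))"
      unfolding norm_vec_def by (rule L2_set_le_sum) simp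
    ultimately show ?thesis by linarith
  qed
  then show ?thesis unfolding bounded_iff by blast
qed

lemma worm_domain_nonempty:
  assumes "(first_index :: 'n::{finite,linorder}) \<noteq> last_index" "\<beta> > 1"
  shows "(worm_domain \<alpha> \<beta> M :: (complex ^ 'n::{finite,linorder}) set) \<noteq> {}"
proof -
  have "wall \<beta> M 1 = 0"
    using assms(2) by (simp add: wall_def)
  then have "axis_point \<alpha> 1 \<in> (worm_domain \<alpha> \<beta> M :: (complex ^ 'n::{finite,linorder}) set)"
    using assms(1) by (simp add: worm_domain_def worm_r_eq axis_point_def)
  then show ?thesis by blast
qed

section \<open>The domain is smooth, bounded and pseudoconvex\<close>

lemma first_neq_last:
  assumes "CARD('n::{finite,linorder}) \<ge> 3"
  shows "(first_index :: 'n) \<noteq> last_index"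
proof
  assume eq: "(first_index :: 'n) = last_index"
  have "x = first_index" for x :: 'n
  proof (rule order.antisym)
    show "x \<le> first_index" unfolding eq by (simp add: last_index_def)
    show "first_index \<le> x" by (simp add: first_index_def)
  qed
  then have "(UNIV :: 'n set) = {first_index}" by auto
  then have "CARD('n) = 1" by (metis card_1_singleton_iff One_nat_def)
  with assms show False by simp
qed

theorem proposition1:
  fixes \<alpha> \<beta> :: real
  assumes "CARD('n::{finite,linorder}) \<ge> 3" and "\<alpha> > 0" and "\<beta> > 1"
  shows "\<exists>M\<^sub>0>0. \<forall>M\<ge>M\<^sub>0.
           smooth_bounded_pseudoconvex_domain (worm_domain \<alpha> \<beta> M :: (complex ^ 'n::{finite,linorder}) set)"
proof (intro exI[of _ "exp 3 :: real"] conjI allI impI)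
  fix M :: real
  assume M: "exp 3 \<le> M"
  let ?\<Omega> = "worm_domain \<alpha> \<beta> M :: (complex ^ 'n::{finite,linorder}) set"
  note ne = first_neq_last[OF assms(1)]
  have pc: "pseudoconvex ?\<Omega>"
    unfolding pseudoconvex_def
  proof (intro ballI)
    fix p assume p: "p \<in> frontier ?\<Omega>"
    define \<rho> where "\<rho> = (\<lambda>z :: complex ^ 'n::{finite,linorder}. (cmod (twist \<alpha> (p $ last_index) (z $ last_index)))\<^sup>2 * worm_r \<alpha> \<beta> M z)"
    obtain U where "p \<in> U" "local_defining_function ?\<Omega> U \<rho>"
      using twisted_local_defining_function[OF ne M assms(3) p] unfolding \<rho>_def by blast
    moreover have "worm_r \<alpha> \<beta> M p \<le> 0"
      using p frontier_worm_domain[OF ne M assms(3)] by simp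
    note b = worm_r_nonpos_bounds[OF M this]
    have "0 \<le> Re (levi_form \<rho> p w)" for w
      unfolding \<rho>_def by (rule levi_form_nonneg[OF levi_nonneg_twisted_worm_r[OF ne b(4) M b(1)]])
    ultimately show "\<exists>U \<rho>. p \<in> U \<and> local_defining_function ?\<Omega> U \<rho> \<and>
        (\<forall>w\<in>complex_tangent \<rho> p. 0 \<le> Re (levi_form \<rho> p w))"
      by blast
  qed
  then have "smooth_boundary ?\<Omega>"
    unfolding pseudoconvex_def smooth_boundary_def by blast
  with pc show "smooth_bounded_pseudoconvex_domain ?\<Omega>"
    unfolding smooth_bounded_pseudoconvex_domain_def is_domain_def
    using open_worm_domain connected_worm_domain[OF ne M assms(3)] worm_domain_nonempty[OF ne assms(3)]
      bounded_worm_domain[OF M assms(3)] by blast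
qed simp

end
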